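(* Let $\{X_i\}_{i=-\infty}^\infty$ be a $\beta$-mixing sequence with values in $\mathcal X$ and let $\Xi_{i,n}=\Xi_n(X_i)$ for each $i$, where $\Xi_n:\mathcal X\to\mathbb R^{d_1\times d_2}$ is a sequence of measurable $d_1\times d_2$ matrix-valued functions. Assume $E[\Xi_{i,n}]=0$ and $\|\Xi_{i,n}\|\le R_n$ for each $i$, and define $s_n^2=\max_{1\le i,j\le n}\max\{\|E[\Xi_{i,n}\Xi_{j,n}']\|,\|E[\Xi_{i,n}'\Xi_{j,n}]\|\}$. Let $q$ be an integer between $1$ and $n/2$, and let $I_r=\{q[n/q]+1,\ldots,n\}$ when $q[n/q]<n$ and $I_r=\emptyset$ when $q[n/q]=n$. Then for all $t\ge0$, $$\mathbb P\left(\left\|\sum_{i=1}^n\Xi_{i,n}\right\|\ge6t\right)\le\frac nq\beta(q)+\mathbb P\left(\left\|\sum_{i\in I_r}\Xi_{i,n}\right\|\ge t\right)+2(d_1+d_2)\exp\left(\frac{-t^2/2}{nqs_n^2+qR_nt/3}\right),$$ where $\|\sum_{i\in I_r}\Xi_{i,n}\|:=0$ whenever $I_r=\emptyset$.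
   Context: $\|\cdot\|$ is the spectral norm (largest singular value); $[\cdot]$ is the integer part; $'$ is transpose. $\beta$-mixing coefficients: for $\sigma$-algebras $\mathcal A,\mathcal B$, $\beta(\mathcal A,\mathcal B)=\frac12\sup\sum_{(i,j)\in I\times J}|\mathbb P(A_i\cap B_j)-\mathbb P(A_i)\mathbb P(B_j)|$, the supremum being over all finite partitions $\{A_i\}_{i\in I}\subset\mathcal A$ and $\{B_j\}_{j\in J}\subset\mathcal B$ of the sample space; $\beta(q)=\sup_i\beta(\sigma(\ldots,X_{i-1},X_i),\sigma(X_{i+q},X_{i+q+1},\ldots))$. The sequence is $\beta$-mixing if $\beta(q)\to0$ as $q\to\infty$. The sequence is not required to be identically distributed. *)

theory Defs
  imports "HOL-Probability.Probability"
begin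

section \<open>Spectral norm\<close>

definition singular_value :: "real^'n^'m \<Rightarrow> real \<Rightarrow> bool" where
  "singular_value A s \<longleftrightarrow>
     0 \<le> s \<and> (\<exists>v. v \<noteq> 0 \<and> (transpose A ** A) *v v = s\<^sup>2 *\<^sub>R v)"

text \<open>The norm that the library puts on \<^typ>\<open>real^'n^'m\<close> is the Frobenius norm, so it
  cannot be used here.\<close>

definition spectral_norm :: "real^'n^'m \<Rightarrow> real" where
  "spectral_norm A = (GREATEST s. singular_value A s)"

text \<open>The largest singular value exists and is the operator norm for the Euclidean norms.\<close>

lemma onorm_transpose_le:
  fixes A :: "real^'n^'m"
  shows "norm (transpose A *v y) \<le> onorm ((*v) A) * norm y"
proof (cases "transpose A *v y = 0")
  case True
  then show ?thesis by (simp add: onorm_pos_le)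
next
  case False
  let ?z = "transpose A *v y"
  have "norm ?z * norm ?z = ?z \<bullet> ?z"
    by (metis dot_square_norm power2_eq_square)
  also have "\<dots> = y \<bullet> (A *v ?z)"
    by (simp add: dot_lmul_matrix)
  also have "\<dots> \<le> norm y * norm (A *v ?z)"
    by (rule norm_cauchy_schwarz)
  also have "\<dots> \<le> norm y * (onorm ((*v) A) * norm ?z)"
    by (intro mult_left_mono onorm matrix_vector_mul_bounded_linear) auto
  finally have "norm ?z * norm ?z \<le> (onorm ((*v) A) * norm y) * norm ?z"
    by (simp add: ac_simps)
  then show ?thesis
    using False by (simp only: mult_le_cancel_right) (auto simp: not_less)
qed

lemma inner_transpose_mult:
  fixes A :: "real^'n^'m"
  shows "((transpose A ** A) *v v) \<bullet> v = (norm (A *v v))\<^sup>2"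
proof -
  have "((transpose A ** A) *v v) \<bullet> v = (transpose A *v (A *v v)) \<bullet> v"
    by (simp only: matrix_vector_mul_assoc)
  also have "\<dots> = (A *v v) \<bullet> (A *v v)"
    by (simp add: dot_lmul_matrix)
  finally show ?thesis
    by (simp add: dot_square_norm)
qed

lemma singular_value_le_onorm:
  fixes A :: "real^'n^'m"
  assumes "singular_value A s"
  shows "s \<le> onorm ((*v) A)"
proof -
  from assms obtain v where v: "v \<noteq> 0" "0 \<le> s" "(transpose A ** A) *v v = s\<^sup>2 *\<^sub>R v"
    by (auto simp: singular_value_def)
  have "(norm (A *v v))\<^sup>2 = (s\<^sup>2 *\<^sub>R v) \<bullet> v"
    using inner_transpose_mult[of A v] v(3) by simp
  also have "\<dots> = (s * norm v)\<^sup>2"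
    by (simp add: power_mult_distrib dot_square_norm)
  finally have "s * norm v = norm (A *v v)"
    using v(2) by (metis norm_ge_zero power2_eq_iff_nonneg mult_nonneg_nonneg)
  also have "\<dots> \<le> onorm ((*v) A) * norm v"
    by (rule onorm[OF matrix_vector_mul_bounded_linear])
  finally show ?thesis
    using v(1) by simp
qed

lemma singular_value_onorm:
  fixes A :: "real^'n^'m"
  shows "singular_value A (onorm ((*v) A))"
proof -
  let ?s = "onorm ((*v) A)"
  have s0: "0 \<le> ?s"
    by (rule onorm_pos_le[OF matrix_vector_mul_bounded_linear])
  have "axis undefined 1 \<in> sphere (0::real^'n) 1"
    by (simp add: norm_axis_1)
  then have ne: "sphere (0::real^'n) 1 \<noteq> {}" by blast
  have "continuous_on (sphere 0 1) (\<lambda>x. norm (A *v x))"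
    by (intro continuous_on_norm linear_continuous_on matrix_vector_mul_bounded_linear)
  then obtain v where v: "norm v = 1"
      and max: "\<And>x. norm x = 1 \<Longrightarrow> norm (A *v x) \<le> norm (A *v v)"
    using continuous_attains_sup[OF compact_sphere ne, of "\<lambda>x. norm (A *v x)"] by auto
  have "?s \<le> norm (A *v v)"
  proof (rule onorm_le)
    fix x
    show "norm (A *v x) \<le> norm (A *v v) * norm x"
    proof (cases "x = 0")
      case False
      have "norm (A *v (inverse (norm x) *\<^sub>R x)) \<le> norm (A *v v)"
        using False by (intro max) simp
      moreover have "A *v (inverse (norm x) *\<^sub>R x) = inverse (norm x) *\<^sub>R (A *v x)"
        by (rule linear_scale[OF matrix_vector_mul_linear])
      ultimately show ?thesis
        using False by (simp add: field_simps)
    qed simp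
  qed
  moreover have "norm (A *v v) \<le> ?s"
    using onorm[OF matrix_vector_mul_bounded_linear, of A v] v by simp
  ultimately have Av: "norm (A *v v) = ?s" by simp
  let ?w = "(transpose A ** A) *v v"
  have "norm ?w \<le> ?s * ?s"
    using onorm_transpose_le[of A "A *v v"] Av by (simp add: matrix_vector_mul_assoc del: transpose_matrix_vector)
  then have "(norm ?w)\<^sup>2 \<le> (?s * ?s)\<^sup>2"
    by (intro power_mono) auto
  then have w: "?w \<bullet> ?w \<le> ?s ^ 4"
    by (simp add: dot_square_norm power2_eq_square power4_eq_xxxx)
  have "(norm (?w - ?s\<^sup>2 *\<^sub>R v))\<^sup>2 = ?w \<bullet> ?w - 2 * ?s\<^sup>2 * (?w \<bullet> v) + ?s ^ 4 * (v \<bullet> v)"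
    unfolding power2_norm_eq_inner
    by (simp add: inner_diff_left inner_diff_right inner_commute
        power2_eq_square power4_eq_xxxx algebra_simps)
  also have "\<dots> \<le> ?s ^ 4 - 2 * ?s\<^sup>2 * ?s\<^sup>2 + ?s ^ 4"
    using w v Av by (simp add: inner_transpose_mult dot_square_norm)
  also have "\<dots> = 0"
    by (simp add: power2_eq_square power4_eq_xxxx)
  finally have "?w = ?s\<^sup>2 *\<^sub>R v" by simp
  moreover have "v \<noteq> 0" using v by auto
  ultimately show ?thesis
    using s0 unfolding singular_value_def by blast
qed

lemma spectral_norm_eq_onorm: "spectral_norm A = onorm ((*v) A)"
  unfolding spectral_norm_def
  by (rule Greatest_equality) (fact singular_value_onorm, fact singular_value_le_onorm)


section \<open>Beta-mixing\<close>

text \<open>Partitions are represented by their set of nonempty parts; empty parts of an indexed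
  partition would contribute nothing to the sum.\<close>

definition finite_partition_in :: "'a measure \<Rightarrow> 'a set set \<Rightarrow> 'a set set \<Rightarrow> bool" where
  "finite_partition_in M \<A> P \<longleftrightarrow> finite P \<and> P \<subseteq> \<A> \<and> partition_on (space M) P"

definition beta_coeff :: "'a measure \<Rightarrow> 'a set set \<Rightarrow> 'a set set \<Rightarrow> real" where
  "beta_coeff M \<A> \<B> =
     1/2 * (SUP (P, Q) \<in> {(P, Q). finite_partition_in M \<A> P \<and> finite_partition_in M \<B> Q}.
              \<Sum>A\<in>P. \<Sum>B\<in>Q. \<bar>measure M (A \<inter> B) - measure M A * measure M B\<bar>)"

definition generated_sigma ::
    "'a measure \<Rightarrow> 'x measure \<Rightarrow> (int \<Rightarrow> 'a \<Rightarrow> 'x) \<Rightarrow> int set \<Rightarrow> 'a set set" where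
  "generated_sigma M N X J =
     sigma_sets (space M) (\<Union>j\<in>J. {X j -` A \<inter> space M | A. A \<in> sets N})"

definition beta_mixing_coeff ::
    "'a measure \<Rightarrow> 'x measure \<Rightarrow> (int \<Rightarrow> 'a \<Rightarrow> 'x) \<Rightarrow> nat \<Rightarrow> real" where
  "beta_mixing_coeff M N X q =
     (SUP i. beta_coeff M (generated_sigma M N X {..i}) (generated_sigma M N X {i + int q..}))"

definition beta_mixing :: "'a measure \<Rightarrow> 'x measure \<Rightarrow> (int \<Rightarrow> 'a \<Rightarrow> 'x) \<Rightarrow> bool" where
  "beta_mixing M N X \<longleftrightarrow> beta_mixing_coeff M N X \<longlonglongrightarrow> 0"

text \<open>All sums in \<^const>\<open>beta_coeff\<close> are at most 2, so on sub-sigma-algebras of a probability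
  space the real-valued suprema above are suprema of bounded sets.\<close>

lemma beta_sum_le_2:
  assumes "prob_space M" "\<A> \<subseteq> sets M" "\<B> \<subseteq> sets M"
    and P: "finite_partition_in M \<A> P" and Q: "finite_partition_in M \<B> Q"
  shows "(\<Sum>A\<in>P. \<Sum>B\<in>Q. \<bar>measure M (A \<inter> B) - measure M A * measure M B\<bar>) \<le> 2"
proof -
  interpret prob_space M by fact
  have sum_inter: "(\<Sum>B\<in>R. measure M (A \<inter> B)) = measure M A"
    if "finite R" "R \<subseteq> sets M" "partition_on (space M) R" "A \<in> sets M" for R A
  proof -
    have "measure M (\<Union>B\<in>R. A \<inter> B) = (\<Sum>B\<in>R. measure M (A \<inter> B))"
    proof (rule finite_measure_finite_Union)
      show "disjoint_family_on (\<lambda>B. A \<inter> B) R"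
        using partition_onD2[OF that(3)] unfolding disjoint_family_on_def disjoint_def by blast
    qed (use that in auto)
    moreover have "(\<Union>B\<in>R. A \<inter> B) = A"
      using that partition_onD1[OF that(3)] sets.sets_into_space[OF that(4)] by blast
    ultimately show ?thesis by simp
  qed
  have sum_1: "(\<Sum>B\<in>R. measure M B) = 1"
    if "finite R" "R \<subseteq> sets M" "partition_on (space M) R" for R
  proof -
    have "(\<Sum>B\<in>R. measure M B) = (\<Sum>B\<in>R. measure M (space M \<inter> B))"
      using that(2) by (intro sum.cong) (auto simp: Int_absorb1 sets.sets_into_space)
    then show ?thesis using sum_inter[OF that sets.top] prob_space by simp
  qed
  have p: "finite P" "P \<subseteq> sets M" "partition_on (space M) P"
   and q: "finite Q" "Q \<subseteq> sets M" "partition_on (space M) Q"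
    using assms by (auto simp: finite_partition_in_def)
  have "(\<Sum>A\<in>P. \<Sum>B\<in>Q. \<bar>measure M (A \<inter> B) - measure M A * measure M B\<bar>)
      \<le> (\<Sum>A\<in>P. \<Sum>B\<in>Q. measure M (A \<inter> B) + measure M A * measure M B)"
    by (intro sum_mono abs_leI)
      (simp_all add: add_nonneg_nonneg add_increasing algebra_simps)
  also have "\<dots> = (\<Sum>A\<in>P. measure M A + measure M A)"
    using p(2) by (intro sum.cong)
      (auto simp: sum.distrib sum_inter[OF q] sum_1[OF q] simp flip: sum_distrib_left)
  also have "\<dots> = 2"
    by (simp only: sum.distrib sum_1[OF p])
  finally show ?thesis .
qed


section \<open>The matrix-valued arrays\<close>

definition max_second_moment ::
    "'a measure \<Rightarrow> (int \<Rightarrow> 'a \<Rightarrow> real^'d2^'d1) \<Rightarrow> nat \<Rightarrow> real" where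
  "max_second_moment M Z n =
     (MAX (i, j) \<in> {1..int n} \<times> {1..int n}.
        max (spectral_norm (integral\<^sup>L M (\<lambda>\<omega>. Z i \<omega> ** transpose (Z j \<omega>))))
            (spectral_norm (integral\<^sup>L M (\<lambda>\<omega>. transpose (Z i \<omega>) ** Z j \<omega>))))"

definition remainder_block :: "nat \<Rightarrow> nat \<Rightarrow> int set" where
  "remainder_block n q = (if q * (n div q) < n then {int (q * (n div q)) + 1..int n} else {})"

end

theory Submission
  imports Defs
begin

text \<open>
Cut \<open>{1..n}\<close> into \<open>n div q\<close> blocks of length \<open>q\<close> and a remainder. If the whole sum has norm at least \<open>6 t\<close> and
the remainder less than \<open>t\<close>, then the sum over the blocks of even or of odd number exceeds \<open>2 t\<close> in norm.
It therefore suffices to bound the tail of the sum over alternate blocks, and two facts do this.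

Mixing: successive blocks of the same parity are separated by \<open>q\<close> indices. If one block is added to the sum of
the preceding ones, the probability of an open event exceeds by at most \<open>\<beta>(q)\<close> the one for an independent copy
of that block (\<open>law_add_le_convolution_plus_beta\<close>). By induction the law of the sum is compared with the
convolution of the laws of the blocks (\<open>law_of_sum_le_sum_law_plus_beta\<close>). The errors of all blocks add up to
at most \<open>(n div q) \<beta>(q)\<close>.

Concentration: for the convolution a matrix Bernstein inequality holds (\<open>matrix_bernstein_sum_law\<close>). A
rectangular matrix is made self-adjoint by dilation, and \<open>tr e\<^sup>S\<close> is bounded in expectation, one independent summand
at a time. The key is the deterministic inequality \<open>trace_exp_add_le\<close>,
\<open>tr e\<^sup>f\<^sup>+\<^sup>g \<le> tr e\<^sup>f + tr (g e\<^sup>f) + tr (g\<^sup>2 e\<^sup>f) / (1 - r/2)\<close> for \<open>\<parallel>g\<parallel> \<le> r < 2\<close>,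
which follows by expanding in eigenbases of \<open>f\<close> and of \<open>f + g\<close> simultaneously. It takes the place of the
Golden-Thompson inequality or of Lieb's theorem. Its constants are weaker than those of the usual Bernstein
bound, but the passage from \<open>6 t\<close> to \<open>2 t\<close> leaves room for this (\<open>bernstein_exponent_le\<close>).

A block has norm at most \<open>q R\<close> and second moments at most \<open>q\<^sup>2 s\<close>, where \<open>s\<close> is the maximal second moment
(\<open>block_second_moment_le\<close>); over at most \<open>n / q\<close> blocks this gives the variance term \<open>n q s\<close>.
\<close>

section \<open>Self-adjoint maps and the spectral theorem\<close>

definition selfadjoint :: "('e::euclidean_space \<Rightarrow> 'e) \<Rightarrow> bool" where
  "selfadjoint f \<longleftrightarrow> linear f \<and> (\<forall>x y. f x \<bullet> y = x \<bullet> f y)"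

text \<open>The eigenvalue of a unit eigenvector \<open>b\<close> is written \<open>b \<bullet> f b\<close>, so that no separate family of
eigenvalues has to be carried along.\<close>

definition eigenbasis :: "('e::euclidean_space \<Rightarrow> 'e) \<Rightarrow> 'e set \<Rightarrow> bool" where
  "eigenbasis f B \<longleftrightarrow> finite B \<and> pairwise orthogonal B \<and> (\<forall>b\<in>B. norm b = 1) \<and> span B = UNIV
     \<and> (\<forall>b\<in>B. f b = (b \<bullet> f b) *\<^sub>R b)"

text \<open>Let \<open>w\<close> be the component of \<open>f v\<close> orthogonal to \<open>v\<close>. Moving from \<open>v\<close> in the direction \<open>w\<close> changes the
quadratic form by \<open>2 e \<parallel>w\<parallel>\<^sup>2\<close> to first order, while the norm changes only to second order; at a maximum
this forces \<open>w = 0\<close>.\<close>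

lemma max_rayleigh_quotient_eigenvector:
  fixes f :: "'e::euclidean_space \<Rightarrow> 'e"
  assumes f: "selfadjoint f" and S: "subspace S" "f ` S \<subseteq> S"
    and v: "v \<in> S" "norm v = 1"
    and max: "\<And>x. x \<in> S \<Longrightarrow> norm x = 1 \<Longrightarrow> x \<bullet> f x \<le> v \<bullet> f v"
  shows "f v = (v \<bullet> f v) *\<^sub>R v"
proof -
  define l where "l = v \<bullet> f v"
  define w where "w = f v - l *\<^sub>R v"
  have lin: "linear f" and sa: "f x \<bullet> y = x \<bullet> f y" for x y
    using f by (auto simp: selfadjoint_def)
  have vv: "v \<bullet> v = 1"
    using v(2) by (simp add: dot_square_norm)
  have w: "w \<in> S"
    using S v(1) by (auto simp: w_def intro!: subspace_diff subspace_scale)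
  have wv: "w \<bullet> v = 0"
    by (simp add: w_def inner_diff_left vv l_def sa)
  have wfv: "w \<bullet> f v = w \<bullet> w"
    using wv by (simp add: w_def inner_diff_right algebra_simps)
  have bound: "x \<bullet> f x \<le> l * (x \<bullet> x)" if "x \<in> S" for x
  proof (cases "x = 0")
    case False
    have "(inverse (norm x) *\<^sub>R x) \<bullet> f (inverse (norm x) *\<^sub>R x) \<le> l"
      unfolding l_def using False that S by (intro max subspace_scale) auto
    then show ?thesis
      using False
      by (simp add: linear_scale[OF lin] dot_square_norm field_simps power2_eq_square)
  qed (simp add: linear_0[OF lin])
  define c where "c = l * (w \<bullet> w) - w \<bullet> f w"
  have c: "0 \<le> c"
    using bound[OF w] by (simp add: c_def)
  have key: "2 * e * (w \<bullet> w) \<le> e\<^sup>2 * c" for e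
  proof -
    have q: "(v + e *\<^sub>R w) \<bullet> f (v + e *\<^sub>R w) \<le> l * ((v + e *\<^sub>R w) \<bullet> (v + e *\<^sub>R w))"
      using S v w by (intro bound subspace_add subspace_scale)
    have q1: "(v + e *\<^sub>R w) \<bullet> f (v + e *\<^sub>R w) = l + 2 * e * (w \<bullet> w) + e\<^sup>2 * (w \<bullet> f w)"
      using wfv sa[of v w]
      by (simp add: linear_add[OF lin] linear_scale[OF lin] inner_add_left inner_add_right
          l_def power2_eq_square algebra_simps inner_commute)
    have q2: "(v + e *\<^sub>R w) \<bullet> (v + e *\<^sub>R w) = 1 + e\<^sup>2 * (w \<bullet> w)"
      using wv by (simp add: inner_add_left inner_add_right vv power2_eq_square inner_commute)
    have "l + 2 * e * (w \<bullet> w) + e\<^sup>2 * (w \<bullet> f w) \<le> l * (1 + e\<^sup>2 * (w \<bullet> w))"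
      using q unfolding q1 q2 .
    then show ?thesis
      by (simp add: c_def algebra_simps)
  qed
  have "w \<bullet> w = 0"
  proof (rule ccontr)
    assume "w \<bullet> w \<noteq> 0"
    then have p: "0 < w \<bullet> w" by (simp add: less_le)
    define e where "e = (w \<bullet> w) / (c + 1)"
    have e: "0 < e" using p c by (simp add: e_def)
    have "e * (2 * (w \<bullet> w)) \<le> e * (e * c)"
      using key[of e] by (simp add: power2_eq_square mult_ac)
    then have "2 * (w \<bullet> w) \<le> e * c" using e by simp
    also have "e * c \<le> w \<bullet> w"
      using c p by (simp add: e_def field_simps)
    finally show False using p by simp
  qed
  then show ?thesis by (simp add: w_def l_def)
qed

text \<open>Split off a maximiser \<open>v\<close> of the Rayleigh quotient on \<open>S\<close>; the orthogonal complement of \<open>v\<close> in \<open>S\<close> is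
again invariant because \<open>f\<close> is self-adjoint, and has smaller dimension.\<close>

lemma spectral_theorem_subspace:
  fixes f :: "'e::euclidean_space \<Rightarrow> 'e"
  assumes f: "selfadjoint f"
  shows "subspace S \<Longrightarrow> f ` S \<subseteq> S \<Longrightarrow>
    \<exists>B. finite B \<and> pairwise orthogonal B \<and> (\<forall>b\<in>B. norm b = 1) \<and> span B = S
      \<and> (\<forall>b\<in>B. f b = (b \<bullet> f b) *\<^sub>R b)"
proof (induction "dim S" arbitrary: S rule: less_induct)
  case less
  note S = less.prems
  have lin: "linear f" and sa: "f x \<bullet> y = x \<bullet> f y" for x y
    using f by (auto simp: selfadjoint_def)
  show ?case
  proof (cases "S = {0}")
    case True
    then show ?thesis by (intro exI[of _ "{}"]) auto
  next
    case False
    then obtain x0 where x0: "x0 \<in> S" "x0 \<noteq> 0"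
      using subspace_0[OF S(1)] by blast
    let ?K = "S \<inter> sphere 0 1"
    have "compact ?K"
      using closed_subspace[OF S(1)] by (simp add: closed_Int_compact)
    moreover have "inverse (norm x0) *\<^sub>R x0 \<in> ?K"
      using x0 S by (auto intro!: subspace_scale)
    moreover have "continuous_on ?K (\<lambda>x. x \<bullet> f x)"
      by (intro continuous_intros linear_continuous_on linear_conv_bounded_linear[THEN iffD1] lin)
    ultimately have "\<exists>v\<in>?K. \<forall>x\<in>?K. x \<bullet> f x \<le> v \<bullet> f v"
      by (intro continuous_attains_sup) auto
    then obtain v where v: "v \<in> S" "norm v = 1"
      and max: "\<And>x. x \<in> S \<Longrightarrow> norm x = 1 \<Longrightarrow> x \<bullet> f x \<le> v \<bullet> f v"
      by auto
    have fv: "f v = (v \<bullet> f v) *\<^sub>R v"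
      by (rule max_rayleigh_quotient_eigenvector[OF f S v max])
    have vv: "v \<bullet> v = 1"
      using v(2) by (simp add: dot_square_norm)
    define T where "T = S \<inter> {x. v \<bullet> x = 0}"
    have T: "subspace T"
      unfolding T_def by (intro subspace_Int[of UNIV, simplified] subspace_inter S subspace_hyperplane)
    have "f ` T \<subseteq> T"
    proof safe
      fix x assume "x \<in> T"
      then have "v \<bullet> f x = 0"
        using sa[of v x] by (subst (asm) fv) (simp add: T_def)
      with \<open>x \<in> T\<close> show "f x \<in> T" using S by (auto simp: T_def)
    qed
    moreover have "dim T < dim S"
    proof -
      have "v \<notin> T" using vv by (simp add: T_def)
      then have "T \<subset> S" using v(1) unfolding T_def by blast
      then show ?thesis
        using T S(1) by (metis dim_psubset span_eq_iff)
    qed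
    ultimately obtain B where B: "finite B" "pairwise orthogonal B" "\<forall>b\<in>B. norm b = 1" "span B = T"
        "\<forall>b\<in>B. f b = (b \<bullet> f b) *\<^sub>R b"
      using less.hyps[OF _ T] by blast
    have BT: "B \<subseteq> T" using B(4) span_superset by blast
    have "span (insert v B) = S"
    proof
      show "span (insert v B) \<subseteq> S"
        using BT v(1) S(1) by (intro span_minimal) (auto simp: T_def)
      show "S \<subseteq> span (insert v B)"
      proof
        fix x assume "x \<in> S"
        then have "x - (v \<bullet> x) *\<^sub>R v \<in> T"
          using S(1) v(1) by (auto simp: T_def inner_diff_right vv intro!: subspace_diff subspace_scale)
        then show "x \<in> span (insert v B)"
          unfolding span_insert B(4) by blast
      qed
    qed
    then show ?thesis
      using B v fv BT by (intro exI[of _ "insert v B"])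
        (auto simp: pairwise_insert T_def orthogonal_def inner_commute)
  qed
qed

lemma eigenbasis_exists:
  assumes "selfadjoint f"
  shows "\<exists>B. eigenbasis f B"
  using spectral_theorem_subspace[OF assms subspace_UNIV] unfolding eigenbasis_def by blast

lemma eigenbasis_expand:
  fixes x :: "'e::euclidean_space"
  assumes "eigenbasis f B"
  shows "(\<Sum>b\<in>B. (x \<bullet> b) *\<^sub>R b) = x"
  using assms by (intro orthonormal_basis_expand) (auto simp: eigenbasis_def)

lemma eigenbasis_parseval:
  fixes x y :: "'e::euclidean_space"
  assumes "eigenbasis f B"
  shows "(\<Sum>b\<in>B. (x \<bullet> b) * (y \<bullet> b)) = x \<bullet> y"
proof -
  have "x \<bullet> y = (\<Sum>b\<in>B. (x \<bullet> b) *\<^sub>R b) \<bullet> y"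
    by (simp add: eigenbasis_expand[OF assms])
  then show ?thesis
    by (simp add: inner_sum_left) (simp add: inner_commute)
qed

lemma card_eigenbasis:
  fixes f :: "'e::euclidean_space \<Rightarrow> 'e"
  assumes "eigenbasis f B"
  shows "card B = DIM('e)"
proof -
  have "0 \<notin> B" using assms by (auto simp: eigenbasis_def)
  then have "independent B"
    using assms by (intro pairwise_orthogonal_independent) (auto simp: eigenbasis_def)
  then have "card B = dim B" by (simp add: dim_eq_card_independent)
  also have "\<dots> = dim (UNIV :: 'e set)"
    using assms by (metis dim_span eigenbasis_def)
  finally show ?thesis by simp
qed

section \<open>The trace of the exponential\<close>

text \<open>This is \<open>tr (z e\<^sup>f)\<close>, evaluated in a chosen eigenbasis of \<open>f\<close>. The inequalities below compare
the sums over two arbitrary eigenbases, so independence of the choice never has to be proved.\<close>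

definition trace_exp_weighted :: "('e::euclidean_space \<Rightarrow> 'e) \<Rightarrow> ('e \<Rightarrow> 'e) \<Rightarrow> real" where
  "trace_exp_weighted f z = (\<Sum>b\<in>(SOME B. eigenbasis f B). exp (b \<bullet> f b) * (b \<bullet> z b))"

abbreviation trace_exp :: "('e::euclidean_space \<Rightarrow> 'e) \<Rightarrow> real" where
  "trace_exp f \<equiv> trace_exp_weighted f (\<lambda>x. x)"

lemma trace_exp_eigenbasis:
  fixes f :: "'e::euclidean_space \<Rightarrow> 'e"
  assumes "selfadjoint f"
  obtains B where "eigenbasis f B"
    "\<And>z. trace_exp_weighted f z = (\<Sum>b\<in>B. exp (b \<bullet> f b) * (b \<bullet> z b))"
    "trace_exp f = (\<Sum>b\<in>B. exp (b \<bullet> f b))"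
proof -
  define B where "B = (SOME B. eigenbasis f B)"
  have B: "eigenbasis f B"
    unfolding B_def using eigenbasis_exists[OF assms] by (rule someI_ex)
  have weighted: "trace_exp_weighted f z = (\<Sum>b\<in>B. exp (b \<bullet> f b) * (b \<bullet> z b))" for z
    by (simp add: trace_exp_weighted_def B_def)
  moreover have "trace_exp f = (\<Sum>b\<in>B. exp (b \<bullet> f b))"
    unfolding weighted using B
    by (intro sum.cong) (auto simp: eigenbasis_def dot_square_norm)
  ultimately show thesis
    using that B by blast
qed

lemma trace_exp_nonneg: "selfadjoint f \<Longrightarrow> 0 \<le> trace_exp f"
  by (erule trace_exp_eigenbasis) (simp add: sum_nonneg)

section \<open>The divided difference of the exponential\<close>

text \<open>The divided difference arises as follows: for eigenvectors \<open>u\<close> of \<open>f + g\<close> and \<open>w\<close> of \<open>f\<close> with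
eigenvalues \<open>a\<close> and \<open>b\<close>, the entry of \<open>e\<^sup>f\<^sup>+\<^sup>g - e\<^sup>f\<close> at \<open>(u, w)\<close> is \<open>exp_slope a b * (u \<bullet> g w)\<close>.\<close>

definition exp_slope :: "real \<Rightarrow> real \<Rightarrow> real" where
  "exp_slope a b = (if a = b then exp a else (exp a - exp b) / (a - b))"

lemma exp_slope_mult: "exp_slope a b * (a - b) = exp a - exp b"
  by (simp add: exp_slope_def)

lemma exp_tangent: "exp a - exp b \<le> exp a * (a - b)" for a b :: real
proof -
  have "exp a * (1 + (b - a)) \<le> exp a * exp (b - a)"
    by (intro mult_left_mono exp_ge_add_one_self) auto
  also have "\<dots> = exp b" by (simp flip: exp_add)
  finally show ?thesis by (simp add: algebra_simps)
qed

lemma exp_slope_commute: "exp_slope a b = exp_slope b a"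
  using minus_divide_divide[of "exp a - exp b" "a - b"] by (simp add: exp_slope_def)

lemma exp_slope_nonneg: "0 \<le> exp_slope a b"
  by (auto simp: exp_slope_def zero_le_divide_iff)

lemma exp_trapezoid:
  fixes x :: real assumes "0 \<le> x"
  shows "exp x - 1 \<le> x * ((exp x + 1) / 2)"
proof -
  let ?f = "\<lambda>x::real. x * ((exp x + 1) / 2) - exp x + 1"
  have "?f 0 \<le> ?f x"
  proof (rule DERIV_nonneg_imp_nondecreasing[OF assms])
    fix y :: real assume "0 \<le> y" "y \<le> x"
    have "(?f has_real_derivative ((exp y + 1) / 2 + y * (exp y / 2) - exp y)) (at y)"
      by (auto intro!: derivative_eq_intros)
    moreover have "0 \<le> (exp y + 1) / 2 + y * (exp y / 2) - exp y"
      using exp_tangent[of y 0] by (simp add: field_simps)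
    ultimately show "\<exists>d. (?f has_real_derivative d) (at y) \<and> 0 \<le> d" by blast
  qed
  then show ?thesis by simp
qed

text \<open>The mean of \<open>exp\<close> over an interval is at most the mean of its endpoint values, by convexity. This bound
separates \<open>a\<close> from \<open>b\<close>, which turns double sums over two eigenbases into traces.\<close>

lemma exp_slope_le: "exp_slope a b \<le> (exp a + exp b) / 2"
proof -
  have main: "exp_slope a b \<le> (exp a + exp b) / 2" if "b < a" for a b
  proof -
    have eb: "exp b * exp (a - b) = exp a"
      by (simp add: exp_diff)
    have "exp b * (exp (a - b) - 1) \<le> exp b * ((a - b) * ((exp (a - b) + 1) / 2))"
      using that by (intro mult_left_mono exp_trapezoid) auto
    also have "\<dots> = (a - b) * ((exp b * exp (a - b) + exp b) / 2)"
      by (simp add: field_simps)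
    finally have "exp a - exp b \<le> (a - b) * ((exp a + exp b) / 2)"
      unfolding right_diff_distrib eb by simp
    then show ?thesis
      using that by (simp add: exp_slope_def pos_divide_le_eq mult.commute del: le_divide_eq_numeral1)
  qed
  consider "a = b" | "a < b" | "b < a" by linarith
  then show ?thesis
  proof cases
    case 2
    then show ?thesis using main[OF 2] exp_slope_commute[of a b] by (simp add: add.commute)
  next
    case 1
    then show ?thesis by (simp add: exp_slope_def)
  qed (rule main)
qed

section \<open>A perturbation inequality for the trace of the exponential\<close>

lemma selfadjoint_inner: "selfadjoint f \<Longrightarrow> f x \<bullet> y = x \<bullet> f y"
  by (simp add: selfadjoint_def)

lemma selfadjoint_add:
  "selfadjoint f \<Longrightarrow> selfadjoint g \<Longrightarrow> selfadjoint (\<lambda>x. f x + g x)"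
  by (simp add: selfadjoint_def linear_compose_add inner_add_left inner_add_right)

lemma selfadjoint_square: "selfadjoint g \<Longrightarrow> selfadjoint (\<lambda>x. g (g x))"
  using linear_compose[of g g] by (simp add: selfadjoint_def o_def)

lemma selfadjoint_id: "selfadjoint (\<lambda>x. x)"
  by (simp add: selfadjoint_def linear_ident)

lemma sum_exp_slope_le:
  fixes c :: "'e::euclidean_space \<Rightarrow> 'e \<Rightarrow> real"
  shows "(\<Sum>u\<in>U. \<Sum>w\<in>W. exp_slope (\<mu> u) (\<nu> w) * (c u w)\<^sup>2)
    \<le> ((\<Sum>u\<in>U. exp (\<mu> u) * (\<Sum>w\<in>W. (c u w)\<^sup>2)) + (\<Sum>w\<in>W. exp (\<nu> w) * (\<Sum>u\<in>U. (c u w)\<^sup>2))) / 2"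
proof -
  have "(\<Sum>u\<in>U. \<Sum>w\<in>W. exp_slope (\<mu> u) (\<nu> w) * (c u w)\<^sup>2)
      \<le> (\<Sum>u\<in>U. \<Sum>w\<in>W. (exp (\<mu> u) + exp (\<nu> w)) / 2 * (c u w)\<^sup>2)"
    by (intro sum_mono mult_right_mono exp_slope_le) auto
  also have "\<dots> = ((\<Sum>u\<in>U. \<Sum>w\<in>W. exp (\<mu> u) * (c u w)\<^sup>2)
      + (\<Sum>u\<in>U. \<Sum>w\<in>W. exp (\<nu> w) * (c u w)\<^sup>2)) / 2"
    by (simp add: sum.distrib sum_divide_distrib add_divide_distrib distrib_right)
  also have "(\<Sum>u\<in>U. \<Sum>w\<in>W. exp (\<nu> w) * (c u w)\<^sup>2) = (\<Sum>w\<in>W. \<Sum>u\<in>U. exp (\<nu> w) * (c u w)\<^sup>2)"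
    by (rule sum.swap)
  finally show ?thesis by (simp add: sum_distrib_left)
qed

text \<open>Write \<open>h = f + g\<close>. Three estimates are combined, all read off from sums over pairs of an eigenvector of
\<open>h\<close> and one of \<open>f\<close>. First, \<open>tr e\<^sup>h - tr e\<^sup>f \<le> tr (g e\<^sup>h)\<close> (Klein's inequality, from the tangent
inequality for \<open>exp\<close>). Second, \<open>tr (g e\<^sup>h) - tr (g e\<^sup>f)\<close> is a sum of divided differences with the
nonnegative weights \<open>(u \<bullet> g w)\<^sup>2\<close>, hence at most the mean of \<open>h1 = tr (g\<^sup>2 e\<^sup>h)\<close> and
\<open>h0 = tr (g\<^sup>2 e\<^sup>f)\<close>. Third, \<open>h1 - h0\<close> has weights \<open>(u \<bullet> g w) (u \<bullet> g\<^sup>2 w)\<close>, which the inequality of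
arithmetic and geometric means and \<open>\<parallel>g\<parallel> \<le> r\<close> bound by \<open>r/2 (h1 + h0)\<close>; so the mean of \<open>h1\<close> and
\<open>h0\<close> is controlled by \<open>h0\<close> alone. The right-hand side depends on \<open>g\<close> only through a linear and a
quadratic term, so its expectation over a random \<open>g\<close> is explicit.\<close>

lemma trace_exp_add_le:
  fixes f g :: "'e::euclidean_space \<Rightarrow> 'e"
  assumes f: "selfadjoint f" and g: "selfadjoint g"
    and bound: "\<And>x. norm (g x) \<le> r * norm x" and r0: "0 \<le> r" "r < 2"
  shows "trace_exp (\<lambda>x. f x + g x)
    \<le> trace_exp f + trace_exp_weighted f g + trace_exp_weighted f (\<lambda>x. g (g x)) / (1 - r / 2)"
proof (cases "r = 0")
  case True
  then have "g = (\<lambda>x. 0)" using bound by (intro ext) auto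
  then show ?thesis by (simp add: trace_exp_weighted_def)
next
  case False
  with r0 have r: "0 < r" "r < 2" by auto
  let ?h = "\<lambda>x. f x + g x"
  let ?gg = "\<lambda>x. g (g x)"
  have h: "selfadjoint ?h" and gg: "selfadjoint ?gg"
    using f g by (auto intro: selfadjoint_add selfadjoint_square)
  obtain U where U: "eigenbasis ?h U"
    and hU: "\<And>z. trace_exp_weighted ?h z = (\<Sum>u\<in>U. exp (u \<bullet> ?h u) * (u \<bullet> z u))"
    using trace_exp_eigenbasis[OF h] by blast
  obtain W where W: "eigenbasis f W"
    and fW: "\<And>z. trace_exp_weighted f z = (\<Sum>w\<in>W. exp (w \<bullet> f w) * (w \<bullet> z w))"
    using trace_exp_eigenbasis[OF f] by blast
  define \<mu> where "\<mu> u = u \<bullet> ?h u" for u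
  define \<nu> where "\<nu> w = w \<bullet> f w" for w
  \<comment> \<open>Move \<open>f + g\<close> to \<open>u\<close> and \<open>f\<close> to \<open>w\<close> in \<open>u \<bullet> (f + g) w = u \<bullet> f w + u \<bullet> g w\<close>.\<close>
  have eig: "u \<bullet> g w = (\<mu> u - \<nu> w) * (u \<bullet> w)" if "u \<in> U" "w \<in> W" for u w
  proof -
    have "?h u = \<mu> u *\<^sub>R u" "f w = \<nu> w *\<^sub>R w"
      using U W that by (simp_all add: eigenbasis_def \<mu>_def \<nu>_def)
    then have "u \<bullet> ?h w = \<mu> u * (u \<bullet> w)" "u \<bullet> f w = \<nu> w * (u \<bullet> w)"
      using selfadjoint_inner[OF h, of u w] by simp_all
    then show ?thesis by (simp add: inner_add_right algebra_simps)
  qed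
  have expU: "trace_exp_weighted ?h z = (\<Sum>u\<in>U. \<Sum>w\<in>W. exp (\<mu> u) * ((u \<bullet> w) * (u \<bullet> z w)))"
    if z: "selfadjoint z" for z
  proof -
    have "u \<bullet> z u = (\<Sum>w\<in>W. (u \<bullet> w) * (u \<bullet> z w))" for u
      using eigenbasis_parseval[OF W, of u "z u"] by (simp add: selfadjoint_inner[OF z])
    then show ?thesis
      unfolding hU \<mu>_def[symmetric] by (simp only: sum_distrib_left)
  qed
  have expW: "trace_exp_weighted f z = (\<Sum>u\<in>U. \<Sum>w\<in>W. exp (\<nu> w) * ((u \<bullet> w) * (u \<bullet> z w)))" for z
  proof -
    have "w \<bullet> z w = (\<Sum>u\<in>U. (u \<bullet> w) * (u \<bullet> z w))" for w
      using eigenbasis_parseval[OF U, of w "z w"] by (simp only: inner_commute)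
    then show ?thesis
      unfolding fW \<nu>_def[symmetric] by (subst sum.swap) (simp only: sum_distrib_left)
  qed
  have diff: "trace_exp_weighted ?h z - trace_exp_weighted f z
      = (\<Sum>u\<in>U. \<Sum>w\<in>W. exp_slope (\<mu> u) (\<nu> w) * ((u \<bullet> g w) * (u \<bullet> z w)))" if "selfadjoint z" for z
    unfolding expU[OF that] expW sum_subtractf[symmetric] left_diff_distrib[symmetric]
      exp_slope_mult[symmetric]
    by (intro sum.cong refl) (simp add: eig mult_ac)
  have sqW: "(\<Sum>w\<in>W. (u \<bullet> z w)\<^sup>2) = z u \<bullet> z u" if "selfadjoint z" for z u
    using eigenbasis_parseval[OF W, of "z u" "z u"]
    by (simp add: power2_eq_square selfadjoint_inner[OF that])
  have sqU: "(\<Sum>u\<in>U. (u \<bullet> z w)\<^sup>2) = z w \<bullet> z w" for z w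
    using eigenbasis_parseval[OF U, of "z w" "z w"]
    by (simp only: power2_eq_square inner_commute)
  define h1 where "h1 = trace_exp_weighted ?h ?gg"
  define h0 where "h0 = trace_exp_weighted f ?gg"
  have slope_g: "(\<Sum>u\<in>U. \<Sum>w\<in>W. exp_slope (\<mu> u) (\<nu> w) * (u \<bullet> g w)\<^sup>2) \<le> (h1 + h0) / 2"
    using sum_exp_slope_le[where c="\<lambda>u w. u \<bullet> g w" and U=U and W=W and \<mu>=\<mu> and \<nu>=\<nu>]
    by (simp add: sqU sqW[OF g] h1_def h0_def hU fW \<mu>_def \<nu>_def selfadjoint_inner[OF g])
  have slope_gg: "(\<Sum>u\<in>U. \<Sum>w\<in>W. exp_slope (\<mu> u) (\<nu> w) * (u \<bullet> g (g w))\<^sup>2) \<le> r\<^sup>2 * ((h1 + h0) / 2)"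
  proof -
    have gg_le: "g (g x) \<bullet> g (g x) \<le> r\<^sup>2 * (x \<bullet> g (g x))" for x
    proof -
      have "(norm (g (g x)))\<^sup>2 \<le> (r * norm (g x))\<^sup>2"
        by (intro power_mono bound) auto
      then show ?thesis
        by (simp add: power2_norm_eq_inner power_mult_distrib selfadjoint_inner[OF g])
    qed
    have "(\<Sum>u\<in>U. exp (\<mu> u) * (\<Sum>w\<in>W. (u \<bullet> g (g w))\<^sup>2)) \<le> r\<^sup>2 * h1"
      unfolding sqW[OF gg] h1_def hU sum_distrib_left \<mu>_def[symmetric]
      by (intro sum_mono) (simp add: mult.left_commute mult_left_mono gg_le)
    moreover have "(\<Sum>w\<in>W. exp (\<nu> w) * (\<Sum>u\<in>U. (u \<bullet> g (g w))\<^sup>2)) \<le> r\<^sup>2 * h0"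
      unfolding sqU h0_def fW sum_distrib_left \<nu>_def[symmetric]
      by (intro sum_mono) (simp add: mult.left_commute mult_left_mono gg_le)
    ultimately show ?thesis
      using sum_exp_slope_le[where c="\<lambda>u w. u \<bullet> g (g w)" and U=U and W=W and \<mu>=\<mu> and \<nu>=\<nu>]
      by (simp add: distrib_left)
  qed
  have "h1 - h0 = (\<Sum>u\<in>U. \<Sum>w\<in>W. exp_slope (\<mu> u) (\<nu> w) * ((u \<bullet> g w) * (u \<bullet> g (g w))))"
    unfolding h1_def h0_def by (rule diff[OF gg])
  also have "\<dots> \<le> (\<Sum>u\<in>U. \<Sum>w\<in>W. exp_slope (\<mu> u) (\<nu> w)
      * (r / 2 * (u \<bullet> g w)\<^sup>2 + 1 / (2 * r) * (u \<bullet> g (g w))\<^sup>2))"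
  proof (intro sum_mono mult_left_mono exp_slope_nonneg)
    fix u w
    have "0 \<le> (r * (u \<bullet> g w) - u \<bullet> g (g w))\<^sup>2 / (2 * r)" using r by simp
    then show "(u \<bullet> g w) * (u \<bullet> g (g w)) \<le> r / 2 * (u \<bullet> g w)\<^sup>2 + 1 / (2 * r) * (u \<bullet> g (g w))\<^sup>2"
      using r by (simp add: power2_eq_square field_simps)
  qed
  also have "\<dots> = r / 2 * (\<Sum>u\<in>U. \<Sum>w\<in>W. exp_slope (\<mu> u) (\<nu> w) * (u \<bullet> g w)\<^sup>2)
      + 1 / (2 * r) * (\<Sum>u\<in>U. \<Sum>w\<in>W. exp_slope (\<mu> u) (\<nu> w) * (u \<bullet> g (g w))\<^sup>2)"
    by (simp only: sum_distrib_left sum.distrib distrib_left mult.left_commute)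
  also have "\<dots> \<le> r / 2 * ((h1 + h0) / 2) + 1 / (2 * r) * (r\<^sup>2 * ((h1 + h0) / 2))"
    using r by (intro add_mono mult_left_mono slope_g slope_gg) auto
  also have "\<dots> = r / 2 * (h1 + h0)"
    using r by (simp add: power2_eq_square field_simps)
  finally have "(h1 + h0) / 2 * (1 - r / 2) \<le> h0"
    by (simp add: field_simps)
  then have h10: "(h1 + h0) / 2 \<le> h0 / (1 - r / 2)"
    using r by (simp add: pos_le_divide_eq)
  have "trace_exp_weighted ?h g - trace_exp_weighted f g \<le> (h1 + h0) / 2"
    using slope_g by (simp add: diff[OF g] power2_eq_square)
  moreover have "trace_exp ?h - trace_exp f \<le> trace_exp_weighted ?h g"
  proof -
    have "(exp (\<mu> u) - exp (\<nu> w)) * ((u \<bullet> w) * (u \<bullet> w)) \<le> exp (\<mu> u) * ((u \<bullet> w) * (u \<bullet> g w))"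
      if "u \<in> U" "w \<in> W" for u w
    proof -
      have "(exp (\<mu> u) - exp (\<nu> w)) * ((u \<bullet> w) * (u \<bullet> w))
          \<le> exp (\<mu> u) * (\<mu> u - \<nu> w) * ((u \<bullet> w) * (u \<bullet> w))"
        by (intro mult_right_mono exp_tangent) auto
      then show ?thesis by (simp add: eig[OF that] mult_ac)
    qed
    then show ?thesis
      unfolding expU[OF selfadjoint_id] expU[OF g] expW sum_subtractf[symmetric] left_diff_distrib[symmetric]
      by (intro sum_mono) 
  qed
  ultimately show ?thesis
    using h10 unfolding h0_def by linarith
qed

text \<open>If all eigenvalues were below \<open>c\<close>, the quadratic form of \<open>f\<close> would be at most \<open>c \<parallel>x\<parallel>\<^sup>2\<close> everywhere.\<close>

lemma trace_exp_gt:
  fixes f :: "'e::euclidean_space \<Rightarrow> 'e"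
  assumes f: "selfadjoint f" and x: "c * (x \<bullet> x) < x \<bullet> f x"
  shows "exp c \<le> trace_exp f"
proof -
  obtain B where B: "eigenbasis f B" "trace_exp f = (\<Sum>b\<in>B. exp (b \<bullet> f b))"
    using trace_exp_eigenbasis[OF f] by blast
  have "\<exists>b\<in>B. c \<le> b \<bullet> f b"
  proof (rule ccontr)
    assume *: "\<not> ?thesis"
    have "x \<bullet> f x = (\<Sum>b\<in>B. (x \<bullet> b) * (f x \<bullet> b))"
      by (rule eigenbasis_parseval[OF B(1), symmetric])
    also have "\<dots> = (\<Sum>b\<in>B. (b \<bullet> f b) * ((x \<bullet> b) * (x \<bullet> b)))"
    proof (intro sum.cong refl)
      fix b assume "b \<in> B"
      then have "f b = (b \<bullet> f b) *\<^sub>R b" using B(1) by (simp add: eigenbasis_def)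
      then have "f x \<bullet> b = (b \<bullet> f b) * (x \<bullet> b)"
        unfolding selfadjoint_inner[OF f] by (metis inner_scaleR_right)
      then show "(x \<bullet> b) * (f x \<bullet> b) = (b \<bullet> f b) * ((x \<bullet> b) * (x \<bullet> b))" by simp
    qed
    also have "\<dots> \<le> (\<Sum>b\<in>B. c * ((x \<bullet> b) * (x \<bullet> b)))"
      using * by (intro sum_mono mult_right_mono) auto
    also have "\<dots> = c * (x \<bullet> x)"
      by (simp add: eigenbasis_parseval[OF B(1)] flip: sum_distrib_left)
    finally show False using x by simp
  qed
  then obtain b where b: "b \<in> B" "c \<le> b \<bullet> f b" by blast
  have "exp c \<le> exp (b \<bullet> f b)" using b by simp
  also have "\<dots> \<le> trace_exp f"
    unfolding B(2) using b(1) B(1) by (intro member_le_sum) (auto simp: eigenbasis_def)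
  finally show ?thesis .
qed

lemma trace_exp_zero: "trace_exp (\<lambda>x::'e::euclidean_space. 0) = DIM('e)"
proof -
  have "selfadjoint (\<lambda>x::'e. 0)" by (simp add: selfadjoint_def linear_zero)
  then obtain B where "eigenbasis (\<lambda>x::'e. 0) B" "trace_exp (\<lambda>x::'e. 0) = (\<Sum>b\<in>B. exp (b \<bullet> 0))"
    by (rule trace_exp_eigenbasis)
  then show ?thesis by (simp add: card_eigenbasis)
qed

lemma trace_exp_weighted_le:
  fixes f z :: "'e::euclidean_space \<Rightarrow> 'e"
  assumes f: "selfadjoint f" and bound: "\<And>x. norm (z x) \<le> d * norm x"
  shows "trace_exp_weighted f z \<le> d * trace_exp f"
proof -
  obtain B where B: "eigenbasis f B"
    and w: "\<And>z. trace_exp_weighted f z = (\<Sum>b\<in>B. exp (b \<bullet> f b) * (b \<bullet> z b))"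
    and t: "trace_exp f = (\<Sum>b\<in>B. exp (b \<bullet> f b))"
    using trace_exp_eigenbasis[OF f] by blast
  have "b \<bullet> z b \<le> d" if "b \<in> B" for b
  proof -
    have "b \<bullet> z b \<le> norm b * norm (z b)" by (rule norm_cauchy_schwarz)
    also have "\<dots> \<le> norm b * (d * norm b)" by (intro mult_left_mono bound) auto
    finally show ?thesis using B that by (simp add: eigenbasis_def)
  qed
  then show ?thesis
    unfolding w[of z] t sum_distrib_left mult.commute[of d]
    by (intro sum_mono mult_left_mono) auto
qed

text \<open>A form of \<open>trace_exp_add_le\<close> without linear and quadratic terms. Applied in both directions it
yields continuity, and thereby measurability, of the trace of the exponential.\<close>

lemma trace_exp_add_le_small:
  fixes f g :: "'e::euclidean_space \<Rightarrow> 'e"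
  assumes f: "selfadjoint f" and g: "selfadjoint g"
    and bound: "\<And>x. norm (g x) \<le> d * norm x" and d: "0 \<le> d" "d \<le> 1"
  shows "trace_exp (\<lambda>x. f x + g x) \<le> (1 + 3 * d) * trace_exp f"
proof -
  let ?T = "trace_exp f"
  have T: "0 \<le> ?T" by (rule trace_exp_nonneg[OF f])
  have "norm (g (g x)) \<le> d\<^sup>2 * norm x" for x
    using order_trans[OF bound[of "g x"] mult_left_mono[OF bound[of x], of d]] d
    by (simp add: power2_eq_square mult.assoc)
  then have "trace_exp_weighted f (\<lambda>x. g (g x)) \<le> d\<^sup>2 * ?T"
    by (rule trace_exp_weighted_le[OF f])
  then have "trace_exp_weighted f (\<lambda>x. g (g x)) / (1 - d / 2) \<le> d\<^sup>2 * ?T / (1 - d / 2)"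
    using d by (intro divide_right_mono) auto
  also have "\<dots> \<le> d\<^sup>2 * ?T / (1 / 2)"
    using d T by (intro divide_left_mono) auto
  also have "\<dots> \<le> 2 * d * ?T"
    using d mult_right_mono[of "d * d" d ?T] mult_left_le[of d d] T
    by (simp add: power2_eq_square)
  finally show ?thesis
    using trace_exp_add_le[OF f g bound] trace_exp_weighted_le[OF f bound] d
    by (simp add: algebra_simps)
qed

lemma continuous_trace_exp:
  fixes D :: "'b::euclidean_space \<Rightarrow> 'e::euclidean_space \<Rightarrow> 'e"
  assumes D: "bounded_bilinear D" and sa: "\<And>x. selfadjoint (D x)"
  shows "continuous_on UNIV (\<lambda>x. trace_exp (D x))"
proof -
  interpret D: bounded_bilinear D by fact
  obtain K where K: "0 < K" "\<And>x e. norm (D x e) \<le> norm x * norm e * K"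
    using D.pos_bounded by blast
  have "isCont (\<lambda>x. trace_exp (D x)) x" for x
    unfolding isCont_def LIM_eq
  proof (intro allI impI)
    fix \<epsilon> :: real assume \<epsilon>: "0 < \<epsilon>"
    let ?T = "\<lambda>x. trace_exp (D x)"
    \<comment> \<open>A step of relative size \<open>d\<close> changes the value at \<open>x\<close> by at most \<open>3 d\<close> times the larger of the two
      values, which is at most \<open>4\<close> times the value at \<open>x\<close>.\<close>
    define d where "d = min 1 (\<epsilon> / (12 * ?T x + 1))"
    have T: "0 \<le> ?T y" for y by (rule trace_exp_nonneg[OF sa])
    have d: "0 < d" "d \<le> 1" "12 * d * ?T x < \<epsilon>"
    proof -
      show "0 < d" "d \<le> 1" using \<epsilon> T[of x] by (simp_all add: d_def)
      have "d * (12 * ?T x + 1) \<le> \<epsilon>"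
        using T[of x] by (simp add: d_def flip: pos_le_divide_eq)
      then show "12 * d * ?T x < \<epsilon>" using \<open>0 < d\<close> by (simp add: algebra_simps)
    qed
    have step: "?T y \<le> (1 + 3 * d) * ?T z" if "norm (y - z) < d / K" for y z
    proof -
      have "norm (D (y - z) e) \<le> d * norm e" for e
      proof -
        have "norm (D (y - z) e) \<le> norm (y - z) * K * norm e"
          using K(2)[of "y - z" e] by (simp add: mult_ac)
        also have "\<dots> \<le> d * norm e"
          using that K(1) by (intro mult_right_mono) (auto simp: pos_less_divide_eq)
        finally show ?thesis .
      qed
      from trace_exp_add_le_small[OF sa[of z] sa this less_imp_le[OF d(1)] d(2)] show ?thesis
        by (simp flip: D.add_left)
    qed
    show "\<exists>s>0. \<forall>y. y \<noteq> x \<and> norm (y - x) < s \<longrightarrow> norm (?T y - ?T x) < \<epsilon>"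
    proof (intro exI[of _ "d / K"] conjI allI impI)
      fix y assume "y \<noteq> x \<and> norm (y - x) < d / K"
      then have up: "?T y \<le> (1 + 3 * d) * ?T x" and lo: "?T x \<le> (1 + 3 * d) * ?T y"
        using step by (auto simp: norm_minus_commute)
      have "(1 + 3 * d) * ?T x \<le> 4 * ?T x"
        using d T by (intro mult_right_mono) auto
      then have "3 * d * ?T y \<le> 3 * d * (4 * ?T x)"
        using up d by (intro mult_left_mono) auto
      moreover have "0 \<le> d * ?T x" using d T by simp
      ultimately show "norm (?T y - ?T x) < \<epsilon>"
        using up lo d(3) by (simp add: algebra_simps)
    qed (use d K in auto)
  qed
  then show ?thesis by (simp add: continuous_on_eq_continuous_at)
qed

section \<open>Exponential moments of sums of independent random elements\<close>

text \<open>The linear term of \<open>trace_exp_add_le\<close> has mean zero; in an eigenbasis of \<open>D x\<close> the quadratic term is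
a sum of terms \<open>\<parallel>D y b\<parallel>\<^sup>2\<close> with weights \<open>e\<^bsup>b \<bullet> D x b\<^esup>\<close>, and those weights sum to
\<open>trace_exp (D x)\<close>. The bilinear map \<open>D\<close> embeds the random element into the self-adjoint maps.\<close>

lemma nn_integral_trace_exp_add_le:
  fixes D :: "'b::euclidean_space \<Rightarrow> 'e::euclidean_space \<Rightarrow> 'e"
  assumes D: "bounded_bilinear D" and sa: "\<And>x. selfadjoint (D x)"
    and r: "0 \<le> r" "r < 2"
    and \<mu>: "prob_space \<mu>" "sets \<mu> = sets borel"
    and mean: "integrable \<mu> (\<lambda>y. y)" "integral\<^sup>L \<mu> (\<lambda>y. y) = 0"
    and bound: "AE y in \<mu>. \<forall>e. norm (D y e) \<le> r * norm e"
    and second: "\<And>e. integral\<^sup>L \<mu> (\<lambda>y. (norm (D y e))\<^sup>2) \<le> v * (norm e)\<^sup>2"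
  shows "(\<integral>\<^sup>+ y. ennreal (trace_exp (D (x + y))) \<partial>\<mu>)
    \<le> ennreal ((1 + v / (1 - r / 2)) * trace_exp (D x))"
proof -
  interpret D: bounded_bilinear D by fact
  interpret \<mu>: prob_space \<mu> by fact
  note [measurable_cong] = \<mu>(2)
  obtain B where B: "eigenbasis (D x) B"
    and w: "\<And>z. trace_exp_weighted (D x) z = (\<Sum>b\<in>B. exp (b \<bullet> D x b) * (b \<bullet> z b))"
    and t: "trace_exp (D x) = (\<Sum>b\<in>B. exp (b \<bullet> D x b))"
    using trace_exp_eigenbasis[OF sa] by blast
  have cont: "continuous_on UNIV (\<lambda>y. D y e)" for e
    by (intro linear_continuous_on D.bounded_linear_left)
  have [measurable]: "(\<lambda>y. D y e) \<in> borel_measurable borel" for e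
    by (intro borel_measurable_continuous_onI cont)
  have int1: "integrable \<mu> (\<lambda>y. b \<bullet> D y b)" for b
    by (intro integrable_inner_right integrable_bounded_linear[OF D.bounded_linear_left] mean)
  have mean1: "integral\<^sup>L \<mu> (\<lambda>y. b \<bullet> D y b) = 0" for b
  proof -
    have "bounded_linear (\<lambda>y. b \<bullet> D y b)"
      by (intro bounded_linear_compose[OF bounded_linear_inner_right D.bounded_linear_left])
    from integral_bounded_linear[OF this mean(1)] mean(2) show ?thesis
      by (simp add: D.zero_left)
  qed
  have int2: "integrable \<mu> (\<lambda>y. (norm (D y b))\<^sup>2)" for b
  proof (rule \<mu>.integrable_const_bound[where B="(r * norm b)\<^sup>2"])
    show "AE y in \<mu>. norm ((norm (D y b))\<^sup>2) \<le> (r * norm b)\<^sup>2"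
      using bound by eventually_elim (auto intro: power_mono)
  qed measurable
  have square: "b \<bullet> D y (D y b) = (norm (D y b))\<^sup>2" for b y
    by (simp add: power2_norm_eq_inner selfadjoint_inner[OF sa])
  define F where "F y = trace_exp (D x) + (\<Sum>b\<in>B. exp (b \<bullet> D x b) * (b \<bullet> D y b))
      + (\<Sum>b\<in>B. exp (b \<bullet> D x b) * (norm (D y b))\<^sup>2) / (1 - r / 2)" for y
  have le: "AE y in \<mu>. trace_exp (D (x + y)) \<le> F y"
    using bound
  proof eventually_elim
    case (elim y)
    moreover have "D (x + y) = (\<lambda>e. D x e + D y e)"
      by (rule ext) (rule D.add_left)
    ultimately show ?case
      using trace_exp_add_le[OF sa[of x] sa[of y] _ r]
      by (simp add: F_def w square)
  qed
  have intF: "integrable \<mu> F"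
    unfolding F_def by (intro Bochner_Integration.integrable_add integrable_divide
        Bochner_Integration.integrable_sum integrable_mult_right int1 int2 \<mu>.integrable_const)
  have "integral\<^sup>L \<mu> F = trace_exp (D x)
      + (\<Sum>b\<in>B. exp (b \<bullet> D x b) * integral\<^sup>L \<mu> (\<lambda>y. (norm (D y b))\<^sup>2)) / (1 - r / 2)"
    unfolding F_def using int1 int2 by (simp add: mean1 \<mu>.prob_space)
  also have "\<dots> \<le> trace_exp (D x) + (\<Sum>b\<in>B. exp (b \<bullet> D x b) * v) / (1 - r / 2)"
  proof -
    have "integral\<^sup>L \<mu> (\<lambda>y. (norm (D y b))\<^sup>2) \<le> v" if "b \<in> B" for b
      using second[of b] B that by (simp add: eigenbasis_def)
    then show ?thesis
      using r by (intro add_left_mono divide_right_mono sum_mono mult_left_mono) auto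
  qed
  also have "\<dots> = (1 + v / (1 - r / 2)) * trace_exp (D x)"
    by (simp add: t distrib_right flip: sum_distrib_right)
  finally have intle: "integral\<^sup>L \<mu> F \<le> (1 + v / (1 - r / 2)) * trace_exp (D x)" .
  have "(\<integral>\<^sup>+ y. ennreal (trace_exp (D (x + y))) \<partial>\<mu>) \<le> (\<integral>\<^sup>+ y. ennreal (F y) \<partial>\<mu>)"
    using le by (intro nn_integral_mono_AE) (auto intro: ennreal_leI)
  also have "\<dots> = ennreal (integral\<^sup>L \<mu> F)"
  proof (rule nn_integral_eq_integral[OF intF])
    show "AE y in \<mu>. 0 \<le> F y"
      using le by eventually_elim (use trace_exp_nonneg[OF sa] in \<open>auto intro: order_trans\<close>)
  qed
  also have "\<dots> \<le> ennreal ((1 + v / (1 - r / 2)) * trace_exp (D x))"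
    by (intro ennreal_leI intle)
  finally show ?thesis .
qed

text \<open>The law of a sum of \<open>k\<close> independent random elements with laws \<open>\<mu> 0, \<mu> 1, \<dots>\<close>.\<close>

primrec sum_law :: "(nat \<Rightarrow> 'b::ordered_euclidean_space measure) \<Rightarrow> nat \<Rightarrow> 'b measure" where
  "sum_law \<mu> 0 = return borel 0"
| "sum_law \<mu> (Suc k) = convolution (sum_law \<mu> k) (\<mu> k)"

lemma sets_sum_law [simp, measurable_cong]: "sets (sum_law \<mu> k) = sets borel"
  by (cases k) auto

lemma prob_space_convolution:
  assumes "prob_space M" "prob_space N" and [measurable_cong]: "sets M = sets borel" "sets N = sets borel"
  shows "prob_space (convolution M N)"
proof -
  interpret M: prob_space M by fact
  interpret N: prob_space N by fact
  interpret pair_prob_space M N ..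
  show ?thesis unfolding convolution_def by (rule prob_space_distr) measurable
qed

lemma prob_space_sum_law:
  assumes "\<And>k. prob_space (\<mu> k)" "\<And>k. sets (\<mu> k) = sets borel"
  shows "prob_space (sum_law \<mu> k)"
  by (induction k) (auto intro!: prob_space_return prob_space_convolution assms)

lemma nn_integral_trace_exp_sum_law_le:
  fixes D :: "'b::ordered_euclidean_space \<Rightarrow> 'e::euclidean_space \<Rightarrow> 'e"
  assumes D: "bounded_bilinear D" and sa: "\<And>x. selfadjoint (D x)"
    and r: "0 \<le> r" "r < 2" and v: "0 \<le> v"
    and \<mu>: "\<And>k. prob_space (\<mu> k)" "\<And>k. sets (\<mu> k) = sets borel"
    and mean: "\<And>k. integrable (\<mu> k) (\<lambda>y. y)" "\<And>k. integral\<^sup>L (\<mu> k) (\<lambda>y. y) = 0"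
    and bound: "\<And>k. AE y in \<mu> k. \<forall>e. norm (D y e) \<le> r * norm e"
    and second: "\<And>k e. integral\<^sup>L (\<mu> k) (\<lambda>y. (norm (D y e))\<^sup>2) \<le> v * (norm e)\<^sup>2"
  shows "(\<integral>\<^sup>+ x. ennreal (trace_exp (D x)) \<partial>sum_law \<mu> k)
    \<le> ennreal ((1 + v / (1 - r / 2)) ^ k * DIM('e))"
proof (induction k)
  have meas[measurable]: "(\<lambda>x. trace_exp (D x)) \<in> borel_measurable borel"
    by (intro borel_measurable_continuous_onI continuous_trace_exp D sa)
  {
    case 0
    have "D 0 = (\<lambda>e. 0)" by (rule ext) (rule bounded_bilinear.zero_left[OF D])
    then show ?case by (simp add: nn_integral_return trace_exp_zero)
  next
    case (Suc k)
    let ?c = "1 + v / (1 - r / 2)"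
    have c: "0 \<le> ?c" using r v by simp
    have "(\<integral>\<^sup>+ x. ennreal (trace_exp (D x)) \<partial>sum_law \<mu> (Suc k))
        = (\<integral>\<^sup>+ x. \<integral>\<^sup>+ y. ennreal (trace_exp (D (x + y))) \<partial>\<mu> k \<partial>sum_law \<mu> k)"
      unfolding sum_law.simps
      by (rule nn_integral_convolution)
        (simp_all add: \<mu> prob_space.finite_measure prob_space_sum_law)
    also have "\<dots> \<le> (\<integral>\<^sup>+ x. ennreal ?c * ennreal (trace_exp (D x)) \<partial>sum_law \<mu> k)"
      using nn_integral_trace_exp_add_le[OF D sa r \<mu> mean bound second] c
      by (intro nn_integral_mono) (simp add: ennreal_mult' )
    also have "\<dots> = ennreal ?c * (\<integral>\<^sup>+ x. ennreal (trace_exp (D x)) \<partial>sum_law \<mu> k)"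
      by (rule nn_integral_cmult) measurable
    also have "\<dots> \<le> ennreal ?c * ennreal (?c ^ k * DIM('e))"
      by (intro mult_left_mono Suc) auto
    also have "\<dots> = ennreal (?c ^ Suc k * DIM('e))"
      using c by (simp add: ennreal_mult'[symmetric] mult.assoc)
    finally show ?case .
  }
qed

section \<open>Replacing dependent by independent summands\<close>

lemma sum_measure_partition:
  assumes "finite_measure M" "finite Q" "Q \<subseteq> sets M" "partition_on (space M) Q" "A \<in> sets M"
  shows "(\<Sum>B\<in>Q. measure M (A \<inter> B)) = measure M A"
proof -
  interpret finite_measure M by fact
  have "measure M (\<Union>B\<in>Q. A \<inter> B) = (\<Sum>B\<in>Q. measure M (A \<inter> B))"
  proof (rule finite_measure_finite_Union)
    show "disjoint_family_on (\<lambda>B. A \<inter> B) Q"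
      using partition_onD2[OF assms(4)] unfolding disjoint_family_on_def disjoint_def by blast
  qed (use assms in auto)
  moreover have "(\<Union>B\<in>Q. A \<inter> B) = A"
    using partition_onD1[OF assms(4)] sets.sets_into_space[OF assms(5)] by blast
  ultimately show ?thesis by simp
qed

text \<open>The differences sum to zero over \<open>P \<times> Q\<close>, so the sum of the positive ones is half of the sum of all
absolute values; this is where the factor 1/2 in the mixing coefficient comes from.\<close>

lemma sum_dependence_le_beta_coeff:
  assumes M: "prob_space M" and \<A>: "\<A> \<subseteq> sets M" and \<B>: "\<B> \<subseteq> sets M"
    and P: "finite_partition_in M \<A> P" and Q: "finite_partition_in M \<B> Q"
    and J: "J \<subseteq> P \<times> Q"
  shows "(\<Sum>(A, B)\<in>J. measure M (A \<inter> B) - measure M A * measure M B) \<le> beta_coeff M \<A> \<B>"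
proof -
  interpret prob_space M by fact
  define c where "c A B = prob (A \<inter> B) - prob A * prob B" for A B
  have p: "finite P" "P \<subseteq> sets M" "partition_on (space M) P"
   and q: "finite Q" "Q \<subseteq> sets M" "partition_on (space M) Q"
    using \<A> \<B> P Q by (auto simp: finite_partition_in_def)
  have one: "(\<Sum>B\<in>Q. prob B) = 1"
  proof -
    have "(\<Sum>B\<in>Q. prob B) = (\<Sum>B\<in>Q. prob (space M \<inter> B))"
      using q(2) by (intro sum.cong) (auto simp: Int_absorb1 sets.sets_into_space)
    then show ?thesis
      using sum_measure_partition[OF finite_measure_axioms q sets.top] prob_space by simp
  qed
  have zero: "(\<Sum>A\<in>P. \<Sum>B\<in>Q. c A B) = 0"
  proof (rule sum.neutral, rule ballI)
    fix A assume "A \<in> P"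
    then show "(\<Sum>B\<in>Q. c A B) = 0"
      using p(2) unfolding c_def sum_subtractf sum_distrib_left[symmetric] one
      by (auto simp: sum_measure_partition[OF finite_measure_axioms q])
  qed
  have "(\<Sum>(A, B)\<in>J. c A B) \<le> (\<Sum>(A, B)\<in>P \<times> Q. (\<bar>c A B\<bar> + c A B) / 2)"
    using p(1) q(1) J
    by (intro order_trans[OF sum_mono sum_mono2]) (auto simp: field_simps abs_if)
  also have "\<dots> = 1/2 * (\<Sum>A\<in>P. \<Sum>B\<in>Q. \<bar>c A B\<bar>)"
    by (simp add: sum.cartesian_product[symmetric] sum_divide_distrib[symmetric] sum.distrib zero)
  also have "\<dots> \<le> beta_coeff M \<A> \<B>"
    unfolding beta_coeff_def c_def
  proof (intro mult_left_mono)
    show "(\<Sum>A\<in>P. \<Sum>B\<in>Q. \<bar>prob (A \<inter> B) - prob A * prob B\<bar>)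
      \<le> (SUP (P, Q) \<in> {(P, Q). finite_partition_in M \<A> P \<and> finite_partition_in M \<B> Q}.
          \<Sum>A\<in>P. \<Sum>B\<in>Q. \<bar>prob (A \<inter> B) - prob A * prob B\<bar>)"
    proof (rule cSUP_upper2[where x="(P, Q)"])
      show "bdd_above ((\<lambda>(P, Q). \<Sum>A\<in>P. \<Sum>B\<in>Q. \<bar>prob (A \<inter> B) - prob A * prob B\<bar>) `
          {(P, Q). finite_partition_in M \<A> P \<and> finite_partition_in M \<B> Q})"
        using beta_sum_le_2[OF M \<A> \<B>] by (intro bdd_aboveI[where M=2]) auto
    qed (use P Q in auto)
  qed simp
  finally show ?thesis by (simp add: c_def)
qed

lemma finite_partition_in_fibres:
  assumes \<kappa>: "\<And>I. I \<in> T \<Longrightarrow> {x \<in> space M. \<kappa> x = I} \<in> \<A>" "\<kappa> ` space M \<subseteq> T" "finite T"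
  shows "finite_partition_in M \<A> ((\<lambda>I. {x \<in> space M. \<kappa> x = I}) ` T - {{}})"
proof -
  have "\<Union> ((\<lambda>I. {x \<in> space M. \<kappa> x = I}) ` T - {{}}) = space M"
  proof
    show "space M \<subseteq> \<Union> ((\<lambda>I. {x \<in> space M. \<kappa> x = I}) ` T - {{}})"
    proof
      fix x assume "x \<in> space M"
      then have "{y \<in> space M. \<kappa> y = \<kappa> x} \<in> (\<lambda>I. {x \<in> space M. \<kappa> x = I}) ` T - {{}}"
        using \<kappa>(2) by blast
      then show "x \<in> \<Union> ((\<lambda>I. {x \<in> space M. \<kappa> x = I}) ` T - {{}})"
        using \<open>x \<in> space M\<close> by blast
    qed
  qed auto
  then show ?thesis
    using \<kappa>(1,3) by (auto simp: finite_partition_in_def partition_on_def disjoint_def)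
qed

text \<open>The values \<open>U x\<close> and \<open>V y\<close> enter a finite union of rectangles only through the index sets \<open>a x\<close> and
\<open>b y\<close> of the sides that contain them. The fibres of \<open>a\<close> and \<open>b\<close> form finite partitions. Over the same pairs of
fibres, the first event is the union of their intersections and the second the union of their products.\<close>

lemma joint_finite_union_le_product_plus_beta:
  fixes A :: "nat \<Rightarrow> 'b set" and B :: "nat \<Rightarrow> 'c set"
  assumes M: "prob_space M" and F: "subalgebra M F" and G: "subalgebra M G"
    and U: "\<And>i. {x \<in> space M. U x \<in> A i} \<in> sets F" and V: "\<And>i. {x \<in> space M. V x \<in> B i} \<in> sets G"
  shows "measure M {x \<in> space M. (U x, V x) \<in> (\<Union>i<N. A i \<times> B i)}
    \<le> measure (M \<Otimes>\<^sub>M M) {p \<in> space (M \<Otimes>\<^sub>M M). (U (fst p), V (snd p)) \<in> (\<Union>i<N. A i \<times> B i)}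
      + beta_coeff M (sets F) (sets G)"
proof -
  interpret prob_space M by fact
  interpret MM: pair_prob_space M M ..
  have sp[simp]: "space F = space M" "space G = space M" and sub: "sets F \<subseteq> sets M" "sets G \<subseteq> sets M"
    using F G by (auto simp: subalgebra_def)
  define a where "a x = {i. i < N \<and> U x \<in> A i}" for x
  define b where "b x = {i. i < N \<and> V x \<in> B i}" for x
  let ?R = "\<Union>i<N. A i \<times> B i"
  define E where "E = {p \<in> space (M \<Otimes>\<^sub>M M). (U (fst p), V (snd p)) \<in> ?R}"
  have fibres: "{x \<in> space M. a x = I} \<in> sets F" "{x \<in> space M. b x = I} \<in> sets G"
    if "I \<subseteq> {..<N}" for I
  proof -
    have [measurable]: "Measurable.pred F (\<lambda>x. U x \<in> A i)" "Measurable.pred G (\<lambda>x. V x \<in> B i)" for i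
      using U V by (simp_all add: pred_def)
    have *: "{x \<in> space M. a x = I} = {x \<in> space F. \<forall>i\<in>{..<N}. U x \<in> A i \<longleftrightarrow> i \<in> I}"
      "{x \<in> space M. b x = I} = {x \<in> space G. \<forall>i\<in>{..<N}. V x \<in> B i \<longleftrightarrow> i \<in> I}"
      using that by (auto simp: a_def b_def)
    show "{x \<in> space M. a x = I} \<in> sets F" "{x \<in> space M. b x = I} \<in> sets G"
      unfolding * by measurable
  qed
  define P where "P = (\<lambda>I. {x \<in> space M. a x = I}) ` Pow {..<N} - {{}}"
  define Q where "Q = (\<lambda>I. {x \<in> space M. b x = I}) ` Pow {..<N} - {{}}"
  have P: "finite_partition_in M (sets F) P" and Q: "finite_partition_in M (sets G) Q"
    unfolding P_def Q_def
    by (rule finite_partition_in_fibres; (use fibres in \<open>auto simp: a_def b_def\<close>))+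
  have fin: "finite P" "finite Q" and PQ: "P \<subseteq> sets M" "Q \<subseteq> sets M"
    and dis: "disjoint P" "disjoint Q"
    using P Q sub by (auto simp: finite_partition_in_def partition_on_def)
  define J where "J = {(C, D). C \<in> P \<and> D \<in> Q \<and> C \<times> D \<subseteq> E}"
  have J: "J \<subseteq> P \<times> Q" by (auto simp: J_def)
  then have finJ: "finite J" using fin by (auto intro: finite_subset)
  have JM: "fst p \<in> sets M" "snd p \<in> sets M" if "p \<in> J" for p
    using that J PQ by (auto simp: subset_eq)
  have Esets: "E \<in> sets (M \<Otimes>\<^sub>M M)"
  proof -
    have "E = (\<Union>i<N. {x \<in> space M. U x \<in> A i} \<times> {x \<in> space M. V x \<in> B i})"
      by (auto simp: E_def space_pair_measure)
    also have "\<dots> \<in> sets (M \<Otimes>\<^sub>M M)" using U V sub by (intro sets.finite_UN pair_measureI) auto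
    finally show ?thesis .
  qed
  have "{x \<in> space M. (U x, V x) \<in> ?R} \<subseteq> (\<Union>p\<in>J. fst p \<inter> snd p)"
  proof safe
    fix x i assume x: "x \<in> space M" "i < N" "U x \<in> A i" "V x \<in> B i"
    let ?C = "{y \<in> space M. a y = a x}" and ?D = "{y \<in> space M. b y = b x}"
    have "?C \<in> P" "?D \<in> Q" using x by (auto simp: P_def Q_def a_def b_def)
    moreover have "?C \<times> ?D \<subseteq> E"
    proof safe
      fix y z assume y: "y \<in> space M" "a y = a x" "z \<in> space M" "b z = b x"
      then have "i \<in> a y" "i \<in> b z" using x by (auto simp: a_def b_def)
      then show "(y, z) \<in> E" using y x by (auto simp: E_def a_def b_def space_pair_measure)
    qed
    ultimately have "(?C, ?D) \<in> J" by (simp add: J_def)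
    then show "x \<in> (\<Union>p\<in>J. fst p \<inter> snd p)" using x by force
  qed
  then have "prob {x \<in> space M. (U x, V x) \<in> ?R} \<le> prob (\<Union>p\<in>J. fst p \<inter> snd p)"
    using finJ JM by (intro finite_measure_mono) auto
  also have "\<dots> \<le> (\<Sum>p\<in>J. prob (fst p \<inter> snd p))"
    using finJ JM by (intro finite_measure_subadditive_finite) auto
  also have "\<dots> = (\<Sum>p\<in>J. prob (fst p) * prob (snd p))
      + (\<Sum>(C, D)\<in>J. prob (C \<inter> D) - prob C * prob D)"
    by (simp add: case_prod_unfold sum_subtractf)
  also have "(\<Sum>p\<in>J. prob (fst p) * prob (snd p)) = (\<Sum>p\<in>J. MM.prob (fst p \<times> snd p))"
    using JM by (intro sum.cong refl) (simp add: measure_def emeasure_pair_measure_Times enn2real_mult)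
  also have "\<dots> = MM.prob (\<Union>p\<in>J. fst p \<times> snd p)"
  proof (rule MM.finite_measure_finite_Union[symmetric])
    show "disjoint_family_on (\<lambda>p. fst p \<times> snd p) J"
      unfolding disjoint_family_on_def
    proof (intro ballI impI)
      fix p p' assume p: "p \<in> J" "p' \<in> J" "p \<noteq> p'"
      then have "fst p \<noteq> fst p' \<or> snd p \<noteq> snd p'" by (simp add: prod_eq_iff)
      moreover have "fst p \<in> P" "snd p \<in> Q" "fst p' \<in> P" "snd p' \<in> Q"
        using p J by (auto simp: subset_eq)
      ultimately have "fst p \<inter> fst p' = {} \<or> snd p \<inter> snd p' = {}"
        using disjointD[OF dis(1)] disjointD[OF dis(2)] by metis
      then show "fst p \<times> snd p \<inter> fst p' \<times> snd p' = {}" by (auto simp: Times_Int_Times)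
    qed
  qed (use finJ JM in auto)
  also have "\<dots> \<le> MM.prob E"
    using Esets by (intro MM.finite_measure_mono) (auto simp: J_def)
  also have "(\<Sum>(C, D)\<in>J. prob (C \<inter> D) - prob C * prob D) \<le> beta_coeff M (sets F) (sets G)"
    by (rule sum_dependence_le_beta_coeff[OF M sub P Q J])
  finally show ?thesis by (simp add: E_def)
qed

lemma open_eq_countable_union_rectangles:
  fixes R :: "('b::second_countable_topology \<times> 'c::second_countable_topology) set"
  assumes "open R"
  obtains A :: "nat \<Rightarrow> 'b set" and B :: "nat \<Rightarrow> 'c set"
  where "\<And>i. open (A i)" "\<And>i. open (B i)" "R = (\<Union>i. A i \<times> B i)"
proof -
  obtain \<AA> :: "'b set set" where \<AA>: "countable \<AA>" "topological_basis \<AA>"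
    using ex_countable_basis by blast
  obtain \<BB> :: "'c set set" where \<BB>: "countable \<BB>" "topological_basis \<BB>"
    using ex_countable_basis by blast
  \<comment> \<open>The empty rectangle makes the family nonempty, so that it has an enumeration by \<open>nat\<close>.\<close>
  define S where "S = insert ({}, {}) {(a, b). a \<in> \<AA> \<and> b \<in> \<BB> \<and> a \<times> b \<subseteq> R}"
  have "countable S"
    unfolding S_def using \<AA>(1) \<BB>(1)
    by (intro countable_insert countable_subset[OF _ countable_SIGMA[of \<AA> "\<lambda>_. \<BB>"]]) auto
  then have S: "range (from_nat_into S) = S" by (intro range_from_nat_into) (auto simp: S_def)
  have "(\<Union>p\<in>S. fst p \<times> snd p) = R"
  proof
    show "R \<subseteq> (\<Union>p\<in>S. fst p \<times> snd p)"
    proof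
      fix p assume "p \<in> R"
      then obtain a b where "open a" "open b" "p \<in> a \<times> b" "a \<times> b \<subseteq> R"
        using open_prod_elim[OF assms] by blast
      moreover obtain x y where p: "p = (x, y)" by force
      ultimately obtain a' b' where "a' \<in> \<AA>" "x \<in> a'" "a' \<subseteq> a" "b' \<in> \<BB>" "y \<in> b'" "b' \<subseteq> b"
        using topological_basisE[OF \<AA>(2), of a x] topological_basisE[OF \<BB>(2), of b y] by (metis mem_Sigma_iff)
      then have "(a', b') \<in> S" "p \<in> a' \<times> b'" using \<open>a \<times> b \<subseteq> R\<close> p by (auto simp: S_def)
      then show "p \<in> (\<Union>p\<in>S. fst p \<times> snd p)" by force
    qed
  qed (auto simp: S_def)
  then have "R = (\<Union>i. fst (from_nat_into S i) \<times> snd (from_nat_into S i))"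
    by (subst (asm) S[symmetric]) simp
  moreover have "open (fst (from_nat_into S i))" "open (snd (from_nat_into S i))" for i
  proof -
    have "from_nat_into S i \<in> S" using S by blast
    then show "open (fst (from_nat_into S i))" "open (snd (from_nat_into S i))"
      using topological_basis_open[OF \<AA>(2)] topological_basis_open[OF \<BB>(2)] by (auto simp: S_def)
  qed
  ultimately show thesis by (intro that)
qed

text \<open>An open set is an increasing union of finite unions of open rectangles, so continuity from below extends the
previous bound. Restricting to open sets avoids an approximation argument for general Borel sets, and it
suffices because open sets are stable under the translations that occur in convolutions.\<close>

lemma joint_open_le_product_plus_beta:
  fixes U :: "'a \<Rightarrow> 'b::second_countable_topology" and V :: "'a \<Rightarrow> 'c::second_countable_topology"
  assumes M: "prob_space M" and F: "subalgebra M F" and G: "subalgebra M G"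
    and U: "U \<in> borel_measurable F" and V: "V \<in> borel_measurable G" and R: "open R"
  shows "measure M {x \<in> space M. (U x, V x) \<in> R}
    \<le> measure (M \<Otimes>\<^sub>M M) {p \<in> space (M \<Otimes>\<^sub>M M). (U (fst p), V (snd p)) \<in> R}
      + beta_coeff M (sets F) (sets G)"
proof -
  interpret prob_space M by fact
  interpret MM: pair_prob_space M M ..
  have sp[simp]: "space F = space M" "space G = space M"
    using F G by (auto simp: subalgebra_def)
  have [measurable]: "U \<in> borel_measurable M" "V \<in> borel_measurable M"
    using U V F G measurable_from_subalg by blast+
  obtain A :: "nat \<Rightarrow> 'b set" and B :: "nat \<Rightarrow> 'c set"
    where A: "\<And>i. open (A i)" and B: "\<And>i. open (B i)" and RAB: "R = (\<Union>i. A i \<times> B i)"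
    using open_eq_countable_union_rectangles[OF R] by blast
  define R' where "R' N = (\<Union>i<N. A i \<times> B i)" for N
  have opR: "open (R' N)" for N
    unfolding R'_def using A B by (intro open_UN ballI open_Times)
  have UV: "{x \<in> space M. (U x, V x) \<in> S} \<in> sets M" if "open S" for S
  proof -
    have "S \<in> sets (borel \<Otimes>\<^sub>M borel)" unfolding borel_prod using that by (rule borel_open)
    then show ?thesis by measurable
  qed
  have UV2: "{p \<in> space (M \<Otimes>\<^sub>M M). (U (fst p), V (snd p)) \<in> S} \<in> sets (M \<Otimes>\<^sub>M M)" if "open S" for S
  proof -
    have "S \<in> sets (borel \<Otimes>\<^sub>M borel)" unfolding borel_prod using that by (rule borel_open)
    then show ?thesis by measurable
  qed
  have "(\<lambda>N. prob {x \<in> space M. (U x, V x) \<in> R' N}) \<longlonglongrightarrow> prob (\<Union>N. {x \<in> space M. (U x, V x) \<in> R' N})"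
    using UV[OF opR] by (intro finite_Lim_measure_incseq) (auto simp: incseq_def R'_def)
  also have "(\<Union>N. {x \<in> space M. (U x, V x) \<in> R' N}) = {x \<in> space M. (U x, V x) \<in> R}"
    by (auto simp: R'_def RAB)
  finally have "(\<lambda>N. prob {x \<in> space M. (U x, V x) \<in> R' N}) \<longlonglongrightarrow> prob {x \<in> space M. (U x, V x) \<in> R}" .
  then show ?thesis
  proof (rule LIMSEQ_le_const2, intro exI allI impI)
    fix N :: nat
    have "{x \<in> space M. U x \<in> A i} \<in> sets F" "{x \<in> space M. V x \<in> B i} \<in> sets G" for i
      using measurable_sets[OF U, of "A i"] measurable_sets[OF V, of "B i"] A[of i] B[of i]
      by (auto simp: vimage_def Int_def conj_commute)
    then have "prob {x \<in> space M. (U x, V x) \<in> R' N}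
        \<le> MM.prob {p \<in> space (M \<Otimes>\<^sub>M M). (U (fst p), V (snd p)) \<in> R' N} + beta_coeff M (sets F) (sets G)"
      unfolding R'_def by (intro joint_finite_union_le_product_plus_beta M F G)
    also have "MM.prob {p \<in> space (M \<Otimes>\<^sub>M M). (U (fst p), V (snd p)) \<in> R' N}
        \<le> MM.prob {p \<in> space (M \<Otimes>\<^sub>M M). (U (fst p), V (snd p)) \<in> R}"
      using UV2[OF R] by (intro MM.finite_measure_mono) (auto simp: R'_def RAB)
    finally show "prob {x \<in> space M. (U x, V x) \<in> R' N}
      \<le> MM.prob {p \<in> space (M \<Otimes>\<^sub>M M). (U (fst p), V (snd p)) \<in> R} + beta_coeff M (sets F) (sets G)"
      by simp
  qed
qed

lemma beta_coeff_nonneg: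
  assumes "prob_space M" "subalgebra M F" "subalgebra M G"
  shows "0 \<le> beta_coeff M (sets F) (sets G)"
  using joint_finite_union_le_product_plus_beta[OF assms, of "\<lambda>_. ()" "\<lambda>_. {}" "\<lambda>_. ()" "\<lambda>_. {}" 0]
  by simp

lemma law_add_le_convolution_plus_beta:
  fixes U V :: "'a \<Rightarrow> 'b::ordered_euclidean_space"
  assumes M: "prob_space M" and F: "subalgebra M F" and G: "subalgebra M G"
    and U: "U \<in> borel_measurable F" and V: "V \<in> borel_measurable G" and C: "open C"
  shows "measure M {x \<in> space M. U x + V x \<in> C}
    \<le> measure (convolution (distr M borel U) (distr M borel V)) C + beta_coeff M (sets F) (sets G)"
proof -
  interpret prob_space M by fact
  interpret MM: pair_prob_space M M ..
  have [measurable]: "U \<in> borel_measurable M" "V \<in> borel_measurable M"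
    using U V F G measurable_from_subalg by blast+
  have [measurable]: "C \<in> sets borel"
    using C by simp
  have "open ((\<lambda>p::'b \<times> 'b. fst p + snd p) -` C)"
    using C by (intro open_vimage continuous_intros)
  from joint_open_le_product_plus_beta[OF M F G U V this]
  have "prob {x \<in> space M. U x + V x \<in> C}
    \<le> MM.prob {p \<in> space (M \<Otimes>\<^sub>M M). U (fst p) + V (snd p) \<in> C} + beta_coeff M (sets F) (sets G)"
    by simp
  also have "MM.prob {p \<in> space (M \<Otimes>\<^sub>M M). U (fst p) + V (snd p) \<in> C}
    = measure (convolution (distr M borel U) (distr M borel V)) C"
  proof -
    interpret dV: prob_space "distr M borel V" by (rule prob_space_distr) measurable
    have "distr M borel U \<Otimes>\<^sub>M distr M borel V
        = distr (M \<Otimes>\<^sub>M M) (borel \<Otimes>\<^sub>M borel) (\<lambda>(x, y). (U x, V y))"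
      by (rule pair_measure_distr) (measurable, rule dV.sigma_finite_measure_axioms)
    then show ?thesis
      unfolding convolution_def
      by (simp add: distr_distr measure_distr o_def case_prod_unfold)
        (simp add: measure_distr vimage_def Int_def conj_commute)
  qed
  finally show ?thesis .
qed

lemma convolution_mono_add:
  fixes L L' K :: "'b::ordered_euclidean_space measure"
  assumes L: "prob_space L" "sets L = sets borel" and L': "prob_space L'" "sets L' = sets borel"
    and K: "prob_space K" "sets K = sets borel"
    and le: "\<And>C. open C \<Longrightarrow> emeasure L C \<le> emeasure L' C + c" and B: "open B"
  shows "emeasure (convolution L K) B \<le> emeasure (convolution L' K) B + c"
proof -
  interpret K: prob_space K by fact
  have fin: "finite_measure L" "finite_measure L'" "finite_measure K"
    using L L' K by (simp_all add: prob_space.finite_measure)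
  have sp: "space L = UNIV" "space L' = UNIV" "space K = UNIV"
    using sets_eq_imp_space_eq[OF L(2)] sets_eq_imp_space_eq[OF L'(2)] sets_eq_imp_space_eq[OF K(2)]
    by simp_all
  have conv: "emeasure (convolution H K) B = (\<integral>\<^sup>+ x. emeasure H {a. a + x \<in> B} \<partial>K)"
    if "finite_measure H" "sets H = sets borel" "space H = UNIV" for H
    using that fin K sp B
    by (subst convolution_commutative) (simp_all add: convolution_emeasure)
  have opn: "open {a. a + x \<in> B}" for x
    using open_vimage[OF B, of "\<lambda>a. a + x"] by (simp add: vimage_def continuous_intros)
  have "(\<lambda>x. emeasure L' {a. a + x \<in> B}) \<in> borel_measurable K"
  proof -
    interpret L': prob_space L' by fact
    have [measurable]: "B \<in> sets borel" using B by simp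
    have [measurable_cong]: "sets L' = sets borel" "sets K = sets borel" by fact+
    have "{p \<in> space (K \<Otimes>\<^sub>M L'). snd p + fst p \<in> B} \<in> sets (K \<Otimes>\<^sub>M L')" by measurable
    from L'.measurable_emeasure_Pair[OF this] show ?thesis
      by (simp add: space_pair_measure sp vimage_def)
  qed
  then have "(\<integral>\<^sup>+ x. emeasure L' {a. a + x \<in> B} + c \<partial>K) = (\<integral>\<^sup>+ x. emeasure L' {a. a + x \<in> B} \<partial>K) + c"
    by (subst nn_integral_add) (simp_all add: K.emeasure_space_1)
  then show ?thesis
    using nn_integral_mono[of K "\<lambda>x. emeasure L {a. a + x \<in> B}" "\<lambda>x. emeasure L' {a. a + x \<in> B} + c"]
      le[OF opn] fin L L' sp by (simp add: conv)
qed

text \<open>This replaces a coupling construction. Each new summand depends on the preceding sum only up to the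
mixing coefficient, and convolving with its law preserves the error accumulated so far. Only the law of the
partial sum enters, never the joint law of the summands.\<close>

lemma law_of_sum_le_sum_law_plus_beta:
  fixes W :: "nat \<Rightarrow> 'a \<Rightarrow> 'b::ordered_euclidean_space"
  assumes M: "prob_space M" and W: "\<And>k. W k \<in> borel_measurable M" and \<beta>: "0 \<le> \<beta>"
    and past: "\<And>k. k < K \<Longrightarrow> subalgebra M (F k)"
      "\<And>k. k < K \<Longrightarrow> (\<lambda>x. \<Sum>j<k. W j x) \<in> borel_measurable (F k)"
    and future: "\<And>k. k < K \<Longrightarrow> subalgebra M (G k)"
      "\<And>k. k < K \<Longrightarrow> W k \<in> borel_measurable (G k)"
    and mixing: "\<And>k. k < K \<Longrightarrow> beta_coeff M (sets (F k)) (sets (G k)) \<le> \<beta>"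
    and B: "open B"
  shows "measure M {x \<in> space M. (\<Sum>j<K. W j x) \<in> B}
    \<le> measure (sum_law (\<lambda>k. distr M borel (W k)) K) B + K * \<beta>"
proof -
  interpret prob_space M by fact
  note W[measurable]
  let ?\<mu> = "\<lambda>k. distr M borel (W k)"
  let ?S = "\<lambda>k. distr M borel (\<lambda>x. \<Sum>j<k. W j x)"
  have \<mu>: "prob_space (?\<mu> k)" for k by (rule prob_space_distr) measurable
  have S: "prob_space (?S k)" for k by (rule prob_space_distr) measurable
  have law: "prob_space (sum_law ?\<mu> k)" for k by (rule prob_space_sum_law) (simp_all add: \<mu>)
  have emeasure_le: "emeasure H B \<le> emeasure H' B + ennreal c \<longleftrightarrow> measure H B \<le> measure H' B + c"
    if "prob_space H" "prob_space H'" "0 \<le> c" for H H' :: "'b measure" and B c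
    using that by (simp add: finite_measure.emeasure_eq_measure prob_space.finite_measure flip: ennreal_plus)
  have "k \<le> K \<Longrightarrow> open B \<Longrightarrow> emeasure (?S k) B \<le> emeasure (sum_law ?\<mu> k) B + ennreal (k * \<beta>)" for k B
  proof (induction k arbitrary: B)
    case 0
    then have "B \<in> sets borel" by simp
    then show ?case by (simp add: emeasure_distr indicator_def emeasure_space_1)
  next
    case (Suc k)
    then have k: "k < K" and [measurable]: "B \<in> sets borel" by auto
    have "measure (?S (Suc k)) B = prob {x \<in> space M. (\<Sum>j<k. W j x) + W k x \<in> B}"
      by (simp add: measure_distr vimage_def Int_def conj_commute)
    also have "\<dots> \<le> measure (convolution (?S k) (?\<mu> k)) B + beta_coeff M (sets (F k)) (sets (G k))"
      using past[OF k] future[OF k] Suc.prems M by (intro law_add_le_convolution_plus_beta)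
    also have "\<dots> \<le> measure (convolution (?S k) (?\<mu> k)) B + \<beta>"
      using mixing[OF k] by simp
    also have "measure (convolution (?S k) (?\<mu> k)) B \<le> measure (sum_law ?\<mu> (Suc k)) B + k * \<beta>"
    proof (subst emeasure_le[symmetric])
      show "emeasure (convolution (?S k) (?\<mu> k)) B \<le> emeasure (sum_law ?\<mu> (Suc k)) B + ennreal (k * \<beta>)"
        unfolding sum_law.simps
        by (rule convolution_mono_add) (use Suc S \<mu> law in auto)
    qed (use \<beta> S \<mu> law[of "Suc k"] in \<open>auto intro: prob_space_convolution simp del: sum_law.simps\<close>)
    finally have "measure (?S (Suc k)) B \<le> measure (sum_law ?\<mu> (Suc k)) B + Suc k * \<beta>"
      by (simp add: algebra_simps)
    then show ?case
      using \<beta> by (subst emeasure_le[OF S law]) auto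
  qed
  from this[of K B] have "measure (?S K) B \<le> measure (sum_law ?\<mu> K) B + K * \<beta>"
    using B \<beta> by (subst (asm) emeasure_le[OF S law]) auto
  moreover have "measure (?S K) B = prob {x \<in> space M. (\<Sum>j<K. W j x) \<in> B}"
    using B by (simp add: measure_distr vimage_def Int_def conj_commute)
  ultimately show ?thesis by simp
qed

section \<open>The spectral norm\<close>

lemma norm_mult_vector_le: "norm (A *v x) \<le> spectral_norm A * norm x"
  for A :: "real^'n^'m"
  unfolding spectral_norm_eq_onorm by (rule onorm[OF matrix_vector_mul_bounded_linear])

lemma norm_transpose_mult_vector_le: "norm (transpose A *v x) \<le> spectral_norm A * norm x"
  for A :: "real^'n^'m"
  unfolding spectral_norm_eq_onorm by (rule onorm_transpose_le)

lemma spectral_norm_nonneg: "0 \<le> spectral_norm A"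
  unfolding spectral_norm_eq_onorm by (rule onorm_pos_le[OF matrix_vector_mul_bounded_linear])

lemma spectral_norm_zero: "spectral_norm (0 :: real^'n^'m) = 0"
proof -
  have "(*v) (0 :: real^'n^'m) = (\<lambda>x. 0)" by (rule ext) simp
  then show ?thesis by (simp add: spectral_norm_eq_onorm onorm_zero)
qed

lemma spectral_norm_add_le: "spectral_norm (A + B) \<le> spectral_norm A + spectral_norm B"
  unfolding spectral_norm_eq_onorm matrix_vector_mult_add_rdistrib
  by (rule onorm_triangle) (rule matrix_vector_mul_bounded_linear)+

lemma spectral_norm_sum_le: "spectral_norm (\<Sum>i\<in>I. A i) \<le> (\<Sum>i\<in>I. spectral_norm (A i))"
  by (induction I rule: infinite_finite_induct)
    (auto simp: spectral_norm_zero intro: order_trans[OF spectral_norm_add_le])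

lemma norm_le_spectral_norm: "norm A \<le> CARD('m) * CARD('n) * spectral_norm A"
  for A :: "real^'n^'m"
proof -
  have "norm A \<le> (\<Sum>i\<in>UNIV. norm (A $ i))"
    by (simp add: norm_vec_def L2_set_le_sum)
  also have "\<dots> \<le> (\<Sum>i\<in>(UNIV::'m set). \<Sum>j\<in>(UNIV::'n set). spectral_norm A)"
    using component_le_onorm[OF matrix_vector_mul_linear, of A]
    by (intro sum_mono order_trans[OF norm_le_l1_cart]) (simp add: spectral_norm_eq_onorm)
  finally show ?thesis by simp
qed

text \<open>The right-hand side is a union of conditions that are open in \<open>A\<close>, which gives measurability, and it
supplies the vector needed to bound the largest eigenvalue of the dilation from below.\<close>

lemma less_spectral_norm_iff: "c < spectral_norm A \<longleftrightarrow> (\<exists>x. c * norm x < norm (A *v x))"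
proof
  show "\<exists>x. c * norm x < norm (A *v x)" if "c < spectral_norm A"
  proof (rule ccontr)
    assume "\<not> ?thesis"
    then have "spectral_norm A \<le> c"
      unfolding spectral_norm_eq_onorm by (intro onorm_le) (auto simp: not_less)
    with that show False by simp
  qed
  show "c < spectral_norm A" if "\<exists>x. c * norm x < norm (A *v x)"
  proof -
    from that obtain x where "c * norm x < norm (A *v x)" by blast
    also have "\<dots> \<le> spectral_norm A * norm x" by (rule norm_mult_vector_le)
    finally show ?thesis by (simp add: mult_less_cancel_right)
  qed
qed

lemma open_spectral_norm_greater: "open {A :: real^'n^'m. c < spectral_norm A}"
proof -
  have "bounded_linear (\<lambda>A :: real^'n^'m. A *v x)" for x
    by (intro linear_conv_bounded_linear[THEN iffD1] linearI)
      (simp_all add: matrix_vector_mult_add_rdistrib scaleR_matrix_vector_assoc)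
  then have "open {A :: real^'n^'m. c * norm x < norm (A *v x)}" for x
    by (intro open_Collect_less continuous_intros linear_continuous_on)
  then show ?thesis
    unfolding less_spectral_norm_iff by (intro open_Collect_ex)
qed

lemma borel_measurable_spectral_norm [measurable]: "spectral_norm \<in> borel_measurable borel"
  by (rule borel_measurableI_greater) (simp add: open_spectral_norm_greater)

section \<open>The self-adjoint dilation of a matrix\<close>

text \<open>The block matrix with zero diagonal blocks and off-diagonal blocks \<open>A\<close> and its transpose. Its largest
eigenvalue is the spectral norm of \<open>A\<close>, and its square is block diagonal, which brings in both second moments
of a rectangular matrix at once. The dimensions add up, whence the factor \<open>d1 + d2\<close>.\<close>

definition dilation :: "real^'n^'m \<Rightarrow> (real^'m) \<times> (real^'n) \<Rightarrow> (real^'m) \<times> (real^'n)" where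
  "dilation A p = (A *v snd p, transpose A *v fst p)"

lemma inner_transpose_mult_vector: "x \<bullet> (transpose A *v y) = (A *v x) \<bullet> y"
  for A :: "real^'n^'m"
  by (metis dot_lmul_matrix inner_commute transpose_matrix_vector)

lemma selfadjoint_dilation: "selfadjoint (\<lambda>p. \<theta> *\<^sub>R dilation A p)"
proof -
  have "linear (\<lambda>p. \<theta> *\<^sub>R dilation A p)"
    by (rule linearI) (simp_all add: dilation_def matrix_vector_right_distrib
        matrix_vector_mult_scaleR scaleR_add_right algebra_simps del: transpose_matrix_vector)
  then show ?thesis
    by (auto simp: selfadjoint_def dilation_def inner_transpose_mult_vector inner_Pair
        inner_commute[of "transpose A *v _"] simp del: transpose_matrix_vector) (simp_all add: inner_commute)
qed

lemma transpose_add: "transpose (A + B) = transpose A + transpose B"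
  by (simp add: transpose_def vec_eq_iff)

lemma bounded_bilinear_dilation: "bounded_bilinear (\<lambda>A p. \<theta> *\<^sub>R dilation A p)"
proof -
  have "linear (\<lambda>A. \<theta> *\<^sub>R dilation A p)" for p :: "(real^'n) \<times> (real^'m)"
    by (rule linearI) (simp_all add: dilation_def transpose_add transpose_scalar
        matrix_vector_mult_add_rdistrib scaleR_matrix_vector_assoc[symmetric] scaleR_add_right
        algebra_simps del: transpose_matrix_vector)
  then show ?thesis
    using selfadjoint_dilation
    unfolding bilinear_conv_bounded_bilinear[symmetric] bilinear_def selfadjoint_def by blast
qed

lemma norm_dilation_square:
  "(norm (\<theta> *\<^sub>R dilation A p))\<^sup>2
    = \<theta>\<^sup>2 * ((norm (A *v snd p))\<^sup>2 + (norm (transpose A *v fst p))\<^sup>2)"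
  by (simp add: dilation_def norm_Pair power_mult_distrib distrib_left del: transpose_matrix_vector)

lemma norm_dilation_le:
  assumes "0 \<le> \<theta>"
  shows "norm (\<theta> *\<^sub>R dilation A p) \<le> \<theta> * spectral_norm A * norm p"
proof (rule power2_le_imp_le)
  have "(norm (A *v snd p))\<^sup>2 + (norm (transpose A *v fst p))\<^sup>2
      \<le> (spectral_norm A * norm (snd p))\<^sup>2 + (spectral_norm A * norm (fst p))\<^sup>2"
    by (intro add_mono power_mono norm_mult_vector_le norm_transpose_mult_vector_le) auto
  also have "\<dots> = (spectral_norm A * norm p)\<^sup>2"
    by (cases p) (simp add: norm_Pair power_mult_distrib algebra_simps)
  finally show "(norm (\<theta> *\<^sub>R dilation A p))\<^sup>2 \<le> (\<theta> * spectral_norm A * norm p)\<^sup>2"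
    unfolding norm_dilation_square using mult_left_mono[of _ _ "\<theta>\<^sup>2"]
    by (simp add: power_mult_distrib mult.assoc)
qed (use assms in \<open>auto simp: spectral_norm_nonneg\<close>)

lemma exp_spectral_norm_le_trace_exp:
  assumes c: "0 \<le> c" "c < spectral_norm A" and \<theta>: "0 < \<theta>"
  shows "exp (\<theta> * c) \<le> trace_exp (\<lambda>p. \<theta> *\<^sub>R dilation A p)"
proof -
  obtain x where x: "c * norm x < norm (A *v x)"
    using c(2) by (auto simp: less_spectral_norm_iff)
  have Ax: "0 < norm (A *v x)"
    using le_less_trans[OF mult_nonneg_nonneg[OF c(1) norm_ge_zero] x] .
  then have nx: "0 < norm x" by auto
  \<comment> \<open>The two components are normalised so that both contribute equally to the quadratic form.\<close>
  define p where "p = (inverse (norm (A *v x)) *\<^sub>R (A *v x), inverse (norm x) *\<^sub>R x)"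
  have "p \<bullet> p = 2"
    using Ax nx dot_square_norm[of "A *v x"] dot_square_norm[of x]
    by (simp add: p_def inner_Pair power2_eq_square field_simps)
  moreover have "p \<bullet> dilation A p = 2 * (norm (A *v x) / norm x)"
    using Ax nx dot_square_norm[of "A *v x"]
    by (simp add: p_def dilation_def inner_Pair inner_transpose_mult_vector matrix_vector_mult_scaleR
        power2_eq_square field_simps del: transpose_matrix_vector)
  moreover have "c < norm (A *v x) / norm x"
    using x nx by (simp add: pos_less_divide_eq)
  ultimately have "c * (p \<bullet> p) < p \<bullet> dilation A p"
    by simp
  then have "\<theta> * c * (p \<bullet> p) < p \<bullet> (\<theta> *\<^sub>R dilation A p)"
    using \<theta> by (simp add: mult.assoc)
  then show ?thesis
    by (rule trace_exp_gt[OF selfadjoint_dilation])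
qed

lemma borel_measurable_mult_vector:
  "(\<lambda>A :: real^'n^'m. A *v x) \<in> borel_measurable borel"
  "(\<lambda>A :: real^'n^'m. transpose A *v y) \<in> borel_measurable borel"
proof -
  have "continuous_on UNIV (\<lambda>A :: real^'n^'m. dilation A p)" for p
    using linear_continuous_on[OF bounded_bilinear.bounded_linear_left[OF bounded_bilinear_dilation[of 1]]]
    by simp
  from continuous_on_fst[OF this[of "(0, x)"]] continuous_on_snd[OF this[of "(y, 0)"]]
  show "(\<lambda>A :: real^'n^'m. A *v x) \<in> borel_measurable borel"
    "(\<lambda>A :: real^'n^'m. transpose A *v y) \<in> borel_measurable borel"
    by (simp_all add: dilation_def borel_measurable_continuous_onI del: transpose_matrix_vector)
qed

section \<open>A matrix Bernstein inequality\<close>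

text \<open>Markov's inequality applied to \<open>trace_exp\<close> of the dilation, whose exponential moment was bounded
summand by summand. The parameter \<open>\<theta>\<close> is left free because a suitable value depends on the
later estimates of \<open>v\<close> and \<open>k\<close>.\<close>

lemma matrix_bernstein_sum_law:
  fixes \<mu> :: "nat \<Rightarrow> (real^'n^'m) measure"
  assumes \<mu>: "\<And>k. prob_space (\<mu> k)" "\<And>k. sets (\<mu> k) = sets borel"
    and mean: "\<And>k. integrable (\<mu> k) (\<lambda>A. A)" "\<And>k. integral\<^sup>L (\<mu> k) (\<lambda>A. A) = 0"
    and bound: "\<And>k. AE A in \<mu> k. spectral_norm A \<le> \<rho>"
    and second: "\<And>k x. integral\<^sup>L (\<mu> k) (\<lambda>A. (norm (A *v x))\<^sup>2) \<le> v * (norm x)\<^sup>2"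
      "\<And>k x. integral\<^sup>L (\<mu> k) (\<lambda>A. (norm (transpose A *v x))\<^sup>2) \<le> v * (norm x)\<^sup>2"
    and v: "0 \<le> v" and \<rho>: "0 \<le> \<rho>" and \<theta>: "0 < \<theta>" "\<theta> * \<rho> < 2" and c: "0 \<le> c"
  shows "measure (sum_law \<mu> k) {A. c < spectral_norm A}
    \<le> (CARD('m) + CARD('n)) * exp (- \<theta> * c + k * (\<theta>\<^sup>2 * v / (1 - \<theta> * \<rho> / 2)))"
proof -
  interpret law: prob_space "sum_law \<mu> k" by (rule prob_space_sum_law[OF \<mu>])
  let ?D = "\<lambda>(A :: real^'n^'m) p. \<theta> *\<^sub>R dilation A p"
  let ?g = "\<theta>\<^sup>2 * v / (1 - \<theta> * \<rho> / 2)"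
  have g: "0 \<le> ?g" using v \<theta> by simp
  have meas: "(\<lambda>A. trace_exp (?D A)) \<in> borel_measurable borel"
    by (intro borel_measurable_continuous_onI continuous_trace_exp bounded_bilinear_dilation
        selfadjoint_dilation)
  have boundD: "AE A in \<mu> k. \<forall>p. norm (?D A p) \<le> \<theta> * \<rho> * norm p" for k
    using bound[of k]
  proof eventually_elim
    case (elim A)
    show ?case
    proof
      fix p
      have "norm (?D A p) \<le> \<theta> * spectral_norm A * norm p"
        using \<theta> by (intro norm_dilation_le) auto
      also have "\<dots> \<le> \<theta> * \<rho> * norm p"
        using elim \<theta> by (intro mult_right_mono mult_left_mono) auto
      finally show "norm (?D A p) \<le> \<theta> * \<rho> * norm p" .
    qed
  qed
  have secondD: "integral\<^sup>L (\<mu> k) (\<lambda>A. (norm (?D A p))\<^sup>2) \<le> \<theta>\<^sup>2 * v * (norm p)\<^sup>2" for k p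
  proof -
    interpret prob_space "\<mu> k" by (rule \<mu>)
    note [measurable_cong] = \<mu>(2)
    have int: "integrable (\<mu> k) (\<lambda>A. (norm (A *v x))\<^sup>2)"
      "integrable (\<mu> k) (\<lambda>A. (norm (transpose A *v y))\<^sup>2)" for x y
    proof -
      note borel_measurable_mult_vector[measurable]
      show "integrable (\<mu> k) (\<lambda>A. (norm (A *v x))\<^sup>2)"
      proof (rule integrable_const_bound[where B="(\<rho> * norm x)\<^sup>2"])
        show "AE A in \<mu> k. norm ((norm (A *v x))\<^sup>2) \<le> (\<rho> * norm x)\<^sup>2"
          using bound[of k]
          by eventually_elim
            (auto intro!: power_mono order_trans[OF norm_mult_vector_le] mult_right_mono)
      qed measurable
      show "integrable (\<mu> k) (\<lambda>A. (norm (transpose A *v y))\<^sup>2)"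
      proof (rule integrable_const_bound[where B="(\<rho> * norm y)\<^sup>2"])
        show "AE A in \<mu> k. norm ((norm (transpose A *v y))\<^sup>2) \<le> (\<rho> * norm y)\<^sup>2"
          using bound[of k]
          by eventually_elim
            (auto intro!: power_mono order_trans[OF norm_transpose_mult_vector_le] mult_right_mono
              simp del: transpose_matrix_vector)
      qed measurable
    qed
    have "integral\<^sup>L (\<mu> k) (\<lambda>A. (norm (?D A p))\<^sup>2)
        = \<theta>\<^sup>2 * (integral\<^sup>L (\<mu> k) (\<lambda>A. (norm (A *v snd p))\<^sup>2)
          + integral\<^sup>L (\<mu> k) (\<lambda>A. (norm (transpose A *v fst p))\<^sup>2))"
      unfolding norm_dilation_square using int by (simp del: transpose_matrix_vector)
    also have "\<dots> \<le> \<theta>\<^sup>2 * (v * (norm (snd p))\<^sup>2 + v * (norm (fst p))\<^sup>2)"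
      by (intro mult_left_mono add_mono second) auto
    also have "\<dots> = \<theta>\<^sup>2 * v * (norm p)\<^sup>2"
      by (cases p) (simp add: norm_Pair algebra_simps)
    finally show ?thesis .
  qed
  have "(\<integral>\<^sup>+ A. ennreal (trace_exp (?D A)) \<partial>sum_law \<mu> k)
      \<le> ennreal ((1 + \<theta>\<^sup>2 * v / (1 - \<theta> * \<rho> / 2)) ^ k * DIM((real^'m) \<times> (real^'n)))"
    using nn_integral_trace_exp_sum_law_le[OF bounded_bilinear_dilation selfadjoint_dilation
        _ \<theta>(2) _ \<mu> mean boundD secondD, where k=k] \<theta> \<rho> v by simp
  also have "\<dots> \<le> ennreal (exp (k * ?g) * (CARD('m) + CARD('n)))"
  proof (rule ennreal_leI)
    have "(1 + ?g) ^ k \<le> exp ?g ^ k"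
      using g by (intro power_mono) (auto simp: add.commute)
    also have "exp ?g ^ k = exp (k * ?g)" by (rule exp_of_nat_mult[symmetric])
    finally show "(1 + ?g) ^ k * DIM((real^'m) \<times> (real^'n)) \<le> exp (k * ?g) * (CARD('m) + CARD('n))"
      by (intro mult_mono) auto
  qed
  finally have moment: "(\<integral>\<^sup>+ A. ennreal (trace_exp (?D A)) \<partial>sum_law \<mu> k)
    \<le> ennreal (exp (k * ?g) * (CARD('m) + CARD('n)))" .
  let ?E = "{A :: real^'n^'m. c < spectral_norm A}"
  have E: "?E \<in> sets (sum_law \<mu> k)"
    using open_spectral_norm_greater[of c] by simp
  have "ennreal (exp (\<theta> * c) * law.prob ?E) = (\<integral>\<^sup>+ A. ennreal (exp (\<theta> * c)) * indicator ?E A \<partial>sum_law \<mu> k)"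
    using E by (simp add: nn_integral_cmult_indicator law.emeasure_eq_measure ennreal_mult')
  also have "\<dots> \<le> (\<integral>\<^sup>+ A. ennreal (trace_exp (?D A)) \<partial>sum_law \<mu> k)"
    using exp_spectral_norm_le_trace_exp[OF c _ \<theta>(1)]
    by (intro nn_integral_mono) (auto simp: indicator_def intro!: ennreal_leI)
  also note moment
  finally have "exp (\<theta> * c) * law.prob ?E \<le> exp (k * ?g) * (CARD('m) + CARD('n))"
    by (subst (asm) ennreal_le_iff) auto
  then have "law.prob ?E \<le> exp (k * ?g) * (CARD('m) + CARD('n)) / exp (\<theta> * c)"
    by (simp add: pos_le_divide_eq mult.commute)
  also have "\<dots> = (CARD('m) + CARD('n)) * exp (- \<theta> * c + k * ?g)"
    unfolding exp_add mult_minus_left exp_minus divide_inverse by (simp only: mult_ac)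
  finally show ?thesis .
qed

section \<open>Second moments of sums over a block\<close>

lemma bounded_linear_inner_mult_vector: "bounded_linear (\<lambda>A :: real^'n^'m. x \<bullet> (A *v y))"
proof -
  have "linear (\<lambda>A :: real^'n^'m. x \<bullet> (A *v y))"
    by (rule linearI)
      (simp_all add: matrix_vector_mult_add_rdistrib inner_add_right scaleR_matrix_vector_assoc[symmetric])
  then show ?thesis by (simp add: linear_conv_bounded_linear)
qed

lemma bounded_bilinear_matrix_mult_transpose:
  "bounded_bilinear (\<lambda>A B. (A :: real^'n^'m) ** transpose (B :: real^'n^'k))"
  "bounded_bilinear (\<lambda>A B. transpose (A :: real^'n^'m) ** (B :: real^'k^'m))"
  unfolding bilinear_conv_bounded_bilinear[symmetric] bilinear_def
  by (auto intro!: linearI simp: matrix_matrix_mult_def transpose_def vec_eq_iff sum_distrib_left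
      sum.distrib algebra_simps)

lemma norm_sum_square_integral_le:
  fixes u :: "'i \<Rightarrow> 'a \<Rightarrow> 'v::real_inner"
  assumes fin: "finite I"
    and int: "\<And>i j. i \<in> I \<Longrightarrow> j \<in> I \<Longrightarrow> integrable M (\<lambda>\<omega>. u i \<omega> \<bullet> u j \<omega>)"
    and le: "\<And>i j. i \<in> I \<Longrightarrow> j \<in> I \<Longrightarrow> integral\<^sup>L M (\<lambda>\<omega>. u i \<omega> \<bullet> u j \<omega>) \<le> c"
  shows "integral\<^sup>L M (\<lambda>\<omega>. (norm (\<Sum>i\<in>I. u i \<omega>))\<^sup>2) \<le> (real (card I))\<^sup>2 * c"
proof -
  have "integral\<^sup>L M (\<lambda>\<omega>. (norm (\<Sum>i\<in>I. u i \<omega>))\<^sup>2)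
      = (\<Sum>i\<in>I. \<Sum>j\<in>I. integral\<^sup>L M (\<lambda>\<omega>. u j \<omega> \<bullet> u i \<omega>))"
    using int by (simp add: power2_norm_eq_inner inner_sum_left inner_sum_right)
  also have "\<dots> \<le> (\<Sum>i\<in>I. \<Sum>j\<in>I. c)"
    by (intro sum_mono le)
  finally show ?thesis by (simp add: power2_eq_square)
qed

lemma borel_measurable_matrix_mult_transpose:
  fixes Y :: "'a \<Rightarrow> real^'n^'m"
  assumes "Y \<in> borel_measurable M"
  shows "Y' \<in> borel_measurable M \<Longrightarrow> (\<lambda>\<omega>. Y \<omega> ** transpose (Y' \<omega> :: real^'n^'k)) \<in> borel_measurable M"
    and "Y'' \<in> borel_measurable M \<Longrightarrow> (\<lambda>\<omega>. transpose (Y \<omega>) ** (Y'' \<omega> :: real^'k^'m)) \<in> borel_measurable M"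
  using assms
  by (auto intro!: borel_measurable_continuous_Pair[where H="\<lambda>A B. A ** transpose B"]
      borel_measurable_continuous_Pair[where H="\<lambda>A B. transpose A ** B"]
      bounded_bilinear.continuous_on[OF bounded_bilinear_matrix_mult_transpose(1)]
      bounded_bilinear.continuous_on[OF bounded_bilinear_matrix_mult_transpose(2)]
      continuous_on_fst continuous_on_snd continuous_on_id)

lemma integrable_bounded_bilinear_bounded:
  assumes "prob_space M" and H: "bounded_bilinear H"
    and meas: "(\<lambda>\<omega>. H (Y \<omega>) (Y' \<omega>)) \<in> borel_measurable M"
    and Y: "AE \<omega> in M. norm (Y \<omega>) \<le> b" and Y': "AE \<omega> in M. norm (Y' \<omega>) \<le> b'"
  shows "integrable M (\<lambda>\<omega>. H (Y \<omega>) (Y' \<omega>) :: 'v::{banach, second_countable_topology})"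
proof -
  interpret prob_space M by fact
  obtain K where K: "\<And>x y. norm (H x y) \<le> norm x * norm y * K" "0 < K"
    using bounded_bilinear.pos_bounded[OF H] by blast
  show ?thesis
  proof (rule integrable_const_bound[OF _ meas])
    show "AE \<omega> in M. norm (H (Y \<omega>) (Y' \<omega>)) \<le> b * b' * K"
      using Y Y'
    proof eventually_elim
      case (elim \<omega>)
      then have "norm (Y \<omega>) * norm (Y' \<omega>) * K \<le> b * b' * K"
        using K(2) order_trans[OF norm_ge_zero elim(1)]
        by (intro mult_right_mono mult_mono) auto
      then show ?case using K(1)[of "Y \<omega>" "Y' \<omega>"] by simp
    qed
  qed
qed

lemma max_second_moment_ge:
  assumes "i \<in> {1..int n}" "j \<in> {1..int n}"
  shows "spectral_norm (integral\<^sup>L M (\<lambda>\<omega>. Z i \<omega> ** transpose (Z j \<omega>))) \<le> max_second_moment M Z n"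
    and "spectral_norm (integral\<^sup>L M (\<lambda>\<omega>. transpose (Z i \<omega>) ** Z j \<omega>)) \<le> max_second_moment M Z n"
proof -
  let ?f = "\<lambda>(i, j). max (spectral_norm (integral\<^sup>L M (\<lambda>\<omega>. Z i \<omega> ** transpose (Z j \<omega>))))
            (spectral_norm (integral\<^sup>L M (\<lambda>\<omega>. transpose (Z i \<omega>) ** Z j \<omega>)))"
  have "?f (i, j) \<le> max_second_moment M Z n"
    unfolding max_second_moment_def using assms by (intro Max_ge) auto
  then show "spectral_norm (integral\<^sup>L M (\<lambda>\<omega>. Z i \<omega> ** transpose (Z j \<omega>))) \<le> max_second_moment M Z n"
    and "spectral_norm (integral\<^sup>L M (\<lambda>\<omega>. transpose (Z i \<omega>) ** Z j \<omega>)) \<le> max_second_moment M Z n"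
    by auto
qed

lemma max_second_moment_nonneg: "1 \<le> n \<Longrightarrow> 0 \<le> max_second_moment M Z n"
  using max_second_moment_ge(1)[where i=1 and j=1 and n=n and M=M and Z=Z] by (auto intro: order_trans[OF spectral_norm_nonneg])

lemma inner_mult_vector_le: "x \<bullet> (A *v x) \<le> spectral_norm A * (norm x)\<^sup>2"
proof -
  have "x \<bullet> (A *v x) \<le> norm x * norm (A *v x)" by (rule norm_cauchy_schwarz)
  also have "\<dots> \<le> norm x * (spectral_norm A * norm x)"
    by (intro mult_left_mono norm_mult_vector_le) auto
  finally show ?thesis by (simp add: power2_eq_square mult_ac)
qed

lemma sum_matrix_vector_mult: "(\<Sum>i\<in>I. A i) *v x = (\<Sum>i\<in>I. A i *v x)" for A :: "'i \<Rightarrow> real^'n^'m"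
  by (induction I rule: infinite_finite_induct) (auto simp: matrix_vector_mult_add_rdistrib)

lemma transpose_sum: "transpose (\<Sum>i\<in>I. A i) = (\<Sum>i\<in>I. transpose (A i))" for A :: "'i \<Rightarrow> real^'n^'m"
  by (simp add: transpose_def vec_eq_iff)

text \<open>Expanding the square gives \<open>(card I)\<^sup>2\<close> cross moments, each bounded by the maximal one. Within a block
the variables may be fully dependent, so all of them count; with at most \<open>n / q\<close> blocks of \<open>q\<^sup>2\<close> moments each,
this is the origin of the factor \<open>n q\<close> in the variance term.\<close>

lemma block_second_moment_le:
  fixes Z :: "int \<Rightarrow> 'a \<Rightarrow> real^'n^'m"
  assumes M: "prob_space M" and Z: "\<And>i. Z i \<in> borel_measurable M"
    and bound: "\<And>i. AE \<omega> in M. spectral_norm (Z i \<omega>) \<le> b" and I: "I \<subseteq> {1..int n}"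
  shows "integral\<^sup>L M (\<lambda>\<omega>. (norm ((\<Sum>i\<in>I. Z i \<omega>) *v x))\<^sup>2)
      \<le> (real (card I))\<^sup>2 * max_second_moment M Z n * (norm x)\<^sup>2"
    and "integral\<^sup>L M (\<lambda>\<omega>. (norm (transpose (\<Sum>i\<in>I. Z i \<omega>) *v y))\<^sup>2)
      \<le> (real (card I))\<^sup>2 * max_second_moment M Z n * (norm y)\<^sup>2"
proof -
  let ?s = "max_second_moment M Z n"
  have fin: "finite I" using I by (rule finite_subset) simp
  have nb: "AE \<omega> in M. norm (Z i \<omega>) \<le> CARD('m) * CARD('n) * b" for i
    using bound[of i]
    by eventually_elim (auto intro!: order_trans[OF norm_le_spectral_norm] mult_left_mono)
  have int: "integrable M (\<lambda>\<omega>. Z i \<omega> ** transpose (Z j \<omega>))"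
    "integrable M (\<lambda>\<omega>. transpose (Z i \<omega>) ** Z j \<omega>)" for i j
    by (intro integrable_bounded_bilinear_bounded[OF M _ _ nb nb]
        bounded_bilinear_matrix_mult_transpose borel_measurable_matrix_mult_transpose Z)+
  have row: "(Z i \<omega> *v x) \<bullet> (Z j \<omega> *v x) = x \<bullet> ((transpose (Z i \<omega>) ** Z j \<omega>) *v x)" for i j \<omega>
    by (simp only: matrix_vector_mul_assoc[symmetric] inner_transpose_mult_vector)
  have col: "(transpose (Z i \<omega>) *v y) \<bullet> (transpose (Z j \<omega>) *v y)
      = y \<bullet> ((Z i \<omega> ** transpose (Z j \<omega>)) *v y)" for i j \<omega>
    using inner_transpose_mult_vector[of y "transpose (Z i \<omega>)" "transpose (Z j \<omega>) *v y"]
    by (simp only: matrix_vector_mul_assoc[symmetric] transpose_transpose)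
  have "integral\<^sup>L M (\<lambda>\<omega>. (norm (\<Sum>i\<in>I. Z i \<omega> *v x))\<^sup>2) \<le> (real (card I))\<^sup>2 * (?s * (norm x)\<^sup>2)"
  proof (rule norm_sum_square_integral_le[OF fin])
    fix i j assume ij: "i \<in> I" "j \<in> I"
    show "integrable M (\<lambda>\<omega>. (Z i \<omega> *v x) \<bullet> (Z j \<omega> *v x))"
      unfolding row by (intro integrable_bounded_linear[OF bounded_linear_inner_mult_vector] int)
    have "integral\<^sup>L M (\<lambda>\<omega>. (Z i \<omega> *v x) \<bullet> (Z j \<omega> *v x))
        = x \<bullet> (integral\<^sup>L M (\<lambda>\<omega>. transpose (Z i \<omega>) ** Z j \<omega>) *v x)"
      unfolding row by (rule integral_bounded_linear[OF bounded_linear_inner_mult_vector int(2)])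
    also have "\<dots> \<le> ?s * (norm x)\<^sup>2"
      using ij I by (intro order_trans[OF inner_mult_vector_le] mult_right_mono max_second_moment_ge) auto
    finally show "integral\<^sup>L M (\<lambda>\<omega>. (Z i \<omega> *v x) \<bullet> (Z j \<omega> *v x)) \<le> ?s * (norm x)\<^sup>2" .
  qed
  then show "integral\<^sup>L M (\<lambda>\<omega>. (norm ((\<Sum>i\<in>I. Z i \<omega>) *v x))\<^sup>2) \<le> (real (card I))\<^sup>2 * ?s * (norm x)\<^sup>2"
    by (simp add: sum_matrix_vector_mult mult.assoc)
  have "integral\<^sup>L M (\<lambda>\<omega>. (norm (\<Sum>i\<in>I. transpose (Z i \<omega>) *v y))\<^sup>2) \<le> (real (card I))\<^sup>2 * (?s * (norm y)\<^sup>2)"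
  proof (rule norm_sum_square_integral_le[OF fin])
    fix i j assume ij: "i \<in> I" "j \<in> I"
    show "integrable M (\<lambda>\<omega>. (transpose (Z i \<omega>) *v y) \<bullet> (transpose (Z j \<omega>) *v y))"
      unfolding col by (intro integrable_bounded_linear[OF bounded_linear_inner_mult_vector] int)
    have "integral\<^sup>L M (\<lambda>\<omega>. (transpose (Z i \<omega>) *v y) \<bullet> (transpose (Z j \<omega>) *v y))
        = y \<bullet> (integral\<^sup>L M (\<lambda>\<omega>. Z i \<omega> ** transpose (Z j \<omega>)) *v y)"
      unfolding col by (rule integral_bounded_linear[OF bounded_linear_inner_mult_vector int(1)])
    also have "\<dots> \<le> ?s * (norm y)\<^sup>2"
      using ij I by (intro order_trans[OF inner_mult_vector_le] mult_right_mono max_second_moment_ge) auto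
    finally show "integral\<^sup>L M (\<lambda>\<omega>. (transpose (Z i \<omega>) *v y) \<bullet> (transpose (Z j \<omega>) *v y)) \<le> ?s * (norm y)\<^sup>2" .
  qed
  then show "integral\<^sup>L M (\<lambda>\<omega>. (norm (transpose (\<Sum>i\<in>I. Z i \<omega>) *v y))\<^sup>2)
      \<le> (real (card I))\<^sup>2 * ?s * (norm y)\<^sup>2"
    by (simp add: transpose_sum sum_matrix_vector_mult mult.assoc del: transpose_matrix_vector)
qed

section \<open>Mixing coefficients of a sequence\<close>

text \<open>The sigma-algebra \<^const>\<open>generated_sigma\<close> as a measure space, so that measurability of functions with
respect to it can be expressed.\<close>

definition generated_space ::
    "'a measure \<Rightarrow> 'x measure \<Rightarrow> (int \<Rightarrow> 'a \<Rightarrow> 'x) \<Rightarrow> int set \<Rightarrow> 'a measure" where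
  "generated_space M N X J = sigma (space M) (\<Union>j\<in>J. {X j -` A \<inter> space M | A. A \<in> sets N})"

lemma sets_generated_space: "sets (generated_space M N X J) = generated_sigma M N X J"
  unfolding generated_space_def generated_sigma_def by (rule sets_measure_of) auto

lemma space_generated_space: "space (generated_space M N X J) = space M"
  unfolding generated_space_def by (rule space_measure_of) auto

lemma subalgebra_generated_space:
  assumes "\<And>i. X i \<in> measurable M N"
  shows "subalgebra M (generated_space M N X J)"
  unfolding subalgebra_def space_generated_space sets_generated_space generated_sigma_def
proof (intro conjI refl sets.sigma_sets_subset)
  show "(\<Union>j\<in>J. {X j -` A \<inter> space M | A. A \<in> sets N}) \<subseteq> sets M"
    using measurable_sets[OF assms] by blast
qed

lemma measurable_generated_space:
  assumes X: "\<And>i. X i \<in> measurable M N" and j: "j \<in> J"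
  shows "X j \<in> measurable (generated_space M N X J) N"
proof (rule measurableI)
  show "X j x \<in> space N" if "x \<in> space (generated_space M N X J)" for x
    using that measurable_space[OF X] by (simp add: space_generated_space)
  show "X j -` A \<inter> space (generated_space M N X J) \<in> sets (generated_space M N X J)"
    if "A \<in> sets N" for A
    unfolding space_generated_space sets_generated_space generated_sigma_def
    using that j by (intro sigma_sets.Basic) auto
qed

text \<open>The supremum over \<open>i\<close> of real numbers bounds its members only because they are bounded above; the bound
1 comes from \<open>beta_sum_le_2\<close>, and the trivial partition shows that the inner suprema are over nonempty
sets.\<close>

lemma beta_coeff_le_beta_mixing_coeff:
  assumes M: "prob_space M" and X: "\<And>i. X i \<in> measurable M N"
  shows "beta_coeff M (generated_sigma M N X {..i}) (generated_sigma M N X {i + int q..})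
    \<le> beta_mixing_coeff M N X q"
proof -
  interpret prob_space M by fact
  have sub: "generated_sigma M N X J \<subseteq> sets M" for J
    using subalgebra_generated_space[where X=X and J=J, OF X] by (simp add: subalgebra_def sets_generated_space)
  have triv: "finite_partition_in M (generated_sigma M N X J) {space M}" for J
    using sets.top[of "generated_space M N X J"] not_empty
    by (simp add: finite_partition_in_def partition_on_def sets_generated_space space_generated_space)
  have "beta_coeff M (generated_sigma M N X I) (generated_sigma M N X J) \<le> 1/2 * 2" for I J
    unfolding beta_coeff_def
  proof (intro mult_left_mono cSUP_least)
    show "{(P, Q). finite_partition_in M (generated_sigma M N X I) P
        \<and> finite_partition_in M (generated_sigma M N X J) Q} \<noteq> {}"
      using triv by blast
  qed (use beta_sum_le_2[OF M sub sub] in auto)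
  then show ?thesis
    unfolding beta_mixing_coeff_def by (intro cSUP_upper bdd_aboveI[where M=1]) auto
qed

lemma beta_mixing_coeff_nonneg:
  assumes "prob_space M" "\<And>i. X i \<in> measurable M N"
  shows "0 \<le> beta_mixing_coeff M N X q"
proof -
  have "0 \<le> beta_coeff M (sets (generated_space M N X {..0})) (sets (generated_space M N X {0 + int q..}))"
    using assms by (intro beta_coeff_nonneg subalgebra_generated_space)
  also have "\<dots> \<le> beta_mixing_coeff M N X q"
    unfolding sets_generated_space using assms by (rule beta_coeff_le_beta_mixing_coeff)
  finally show ?thesis .
qed

section \<open>Sums over alternate blocks\<close>

definition block :: "nat \<Rightarrow> nat \<Rightarrow> int set" where
  "block q k = {int (k * q) + 1..int (Suc k * q)}"

lemma card_block: "card (block q k) = q"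
  by (simp add: block_def)

text \<open>Blocks of one parity, \<open>p = 0\<close> or \<open>p = 1\<close>, are separated by gaps of length \<open>q\<close>. Hence the law of the sum over
\<open>K\<close> of them exceeds a convolution on open sets by at most \<open>K \<beta>(q)\<close>, and to the convolution the
Bernstein inequality applies.\<close>

lemma alternate_blocks_tail_le:
  fixes \<Xi> :: "'x \<Rightarrow> real^'n^'m" and X :: "int \<Rightarrow> 'a \<Rightarrow> 'x"
  defines "Z \<equiv> \<lambda>i \<omega>. \<Xi> (X i \<omega>)"
  assumes M: "prob_space M" and X: "\<And>i. X i \<in> measurable M N" and \<Xi>: "\<Xi> \<in> borel_measurable N"
    and mean: "\<And>i. integral\<^sup>L M (Z i) = 0"
    and bound: "\<And>i. AE \<omega> in M. spectral_norm (Z i \<omega>) \<le> b" and b: "0 \<le> b"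
    and K: "(2 * K + p) * q \<le> n + q" and n: "1 \<le> n" and p: "p \<le> 1"
    and \<theta>: "0 < \<theta>" "\<theta> * (q * b) < 2" and c: "0 \<le> c"
  shows "measure M {\<omega> \<in> space M. c < spectral_norm (\<Sum>k<K. \<Sum>i\<in>block q (2 * k + p). Z i \<omega>)}
    \<le> (CARD('m) + CARD('n)) * exp (- \<theta> * c
        + K * (\<theta>\<^sup>2 * ((real q)\<^sup>2 * max_second_moment M (Z) n) / (1 - \<theta> * (q * b) / 2)))
      + K * beta_mixing_coeff M N X q"
proof -
  interpret prob_space M by fact
  let ?s = "max_second_moment M (Z) n"
  \<comment> \<open>The lemmas on laws take an infinite sequence of summands; only the first \<open>K\<close> blocks are known
    to lie in \<open>{1..n}\<close>, where the second moments are controlled, so the others are emptied.\<close>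
  define B where "B k = (if k < K then block q (2 * k + p) else {})" for k
  define W where "W k \<omega> = (\<Sum>i\<in>B k. Z i \<omega>)" for k \<omega>
  have B: "B k \<subseteq> {1..int n}" "card (B k) \<le> q" for k
  proof -
    have *: "Suc (2 * k + p) * q \<le> n" if "k < K"
    proof -
      have "Suc (Suc (2 * k + p)) * q \<le> (2 * K + p) * q"
        using that by (intro mult_right_mono) auto
      then show ?thesis using K by simp
    qed
    show "B k \<subseteq> {1..int n}"
      using * by (auto simp: B_def block_def simp del: mult_Suc of_nat_mult dest!: of_nat_mono[where 'a=int])
    show "card (B k) \<le> q" by (simp add: B_def card_block)
  qed
  have ZF: "Z i \<in> borel_measurable F" if "X i \<in> measurable F N" for i F
    unfolding Z_def using that \<Xi> by measurable
  have [measurable]: "Z i \<in> borel_measurable M" for i by (rule ZF[OF X])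
  have [measurable]: "W k \<in> borel_measurable M" for k unfolding W_def by measurable
  have int: "integrable M (Z i)" for i
  proof (rule integrable_const_bound[where B="CARD('m) * CARD('n) * b"])
    show "AE \<omega> in M. norm (Z i \<omega>) \<le> CARD('m) * CARD('n) * b"
      using bound[of i]
      by eventually_elim (auto intro!: order_trans[OF norm_le_spectral_norm] mult_left_mono)
  qed measurable
  have s: "0 \<le> ?s" by (rule max_second_moment_nonneg[OF n])
  have card_sq: "(real (card (B k)))\<^sup>2 * ?s * (norm z)\<^sup>2 \<le> (real q)\<^sup>2 * ?s * (norm z)\<^sup>2" for k and z :: "'v::real_normed_vector"
    using B(2)[of k] s by (intro mult_right_mono) (auto intro!: power_mono simp flip: of_nat_power)
  let ?\<mu> = "\<lambda>k. distr M borel (W k)"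
  have \<mu>: "prob_space (?\<mu> k)" for k by (rule prob_space_distr) measurable
  have law: "measure (sum_law ?\<mu> K) {A. c < spectral_norm A}
    \<le> (CARD('m) + CARD('n)) * exp (- \<theta> * c + K * (\<theta>\<^sup>2 * ((real q)\<^sup>2 * ?s) / (1 - \<theta> * (q * b) / 2)))"
  proof (rule matrix_bernstein_sum_law[OF \<mu>])
    fix k
    show "integrable (?\<mu> k) (\<lambda>A. A)" "integral\<^sup>L (?\<mu> k) (\<lambda>A. A) = 0"
      using int mean by (simp_all add: integrable_distr_eq integral_distr W_def)
    show "AE A in ?\<mu> k. spectral_norm A \<le> q * b"
    proof (subst AE_distr_iff)
      have "finite (B k)" by (simp add: B_def block_def)
      then have "AE \<omega> in M. \<forall>i\<in>B k. spectral_norm (Z i \<omega>) \<le> b"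
        using bound by (simp add: AE_finite_all)
      then show "AE \<omega> in M. spectral_norm (W k \<omega>) \<le> q * b"
      proof eventually_elim
        case (elim \<omega>)
        have "spectral_norm (W k \<omega>) \<le> (\<Sum>i\<in>B k. b)"
          unfolding W_def using elim by (intro order_trans[OF spectral_norm_sum_le] sum_mono) auto
        also have "\<dots> \<le> q * b" using B(2)[of k] b by (simp add: mult_right_mono)
        finally show ?case .
      qed
    qed measurable
    show "integral\<^sup>L (?\<mu> k) (\<lambda>A. (norm (A *v x))\<^sup>2) \<le> (real q)\<^sup>2 * ?s * (norm x)\<^sup>2" for x
    proof -
      have [measurable]: "(\<lambda>A :: real^'n^'m. A *v x) \<in> borel_measurable borel"
        by (rule borel_measurable_mult_vector(1))
      have "integral\<^sup>L M (\<lambda>\<omega>. (norm (W k \<omega> *v x))\<^sup>2) \<le> (real q)\<^sup>2 * ?s * (norm x)\<^sup>2"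
        unfolding W_def
        by (rule order_trans[OF block_second_moment_le(1)[OF M _ bound B(1)] card_sq]) measurable
      then show ?thesis
        by (simp add: integral_distr)
    qed
    show "integral\<^sup>L (?\<mu> k) (\<lambda>A. (norm (transpose A *v x))\<^sup>2) \<le> (real q)\<^sup>2 * ?s * (norm x)\<^sup>2" for x
    proof -
      have [measurable]: "(\<lambda>A :: real^'n^'m. transpose A *v x) \<in> borel_measurable borel"
        by (rule borel_measurable_mult_vector(2))
      have "integral\<^sup>L M (\<lambda>\<omega>. (norm (transpose (W k \<omega>) *v x))\<^sup>2) \<le> (real q)\<^sup>2 * ?s * (norm x)\<^sup>2"
        unfolding W_def
        by (rule order_trans[OF block_second_moment_le(2)[OF M _ bound B(1)] card_sq]) measurable
      then show ?thesis
        by (simp add: integral_distr del: transpose_matrix_vector)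
    qed
  qed (use s b \<theta> c in auto)
  \<comment> \<open>Block \<open>2 * k + p\<close> starts at \<open>i0 k + q + 1\<close>; its predecessors of the same parity end at
    \<open>i0 k\<close>, because one block of the other parity lies in between.\<close>
  define i0 where "i0 k = (int (2 * k + p) - 1) * int q" for k
  let ?F = "\<lambda>k. generated_space M N X {..i0 k}"
  let ?G = "\<lambda>k. generated_space M N X {i0 k + int q..}"
  have "measure M {\<omega> \<in> space M. (\<Sum>k<K. W k \<omega>) \<in> {A. c < spectral_norm A}}
    \<le> measure (sum_law ?\<mu> K) {A. c < spectral_norm A} + K * beta_mixing_coeff M N X q"
  proof (rule law_of_sum_le_sum_law_plus_beta[where F="?F" and G="?G"])
    fix k assume k: "k < K"
    show "(\<lambda>\<omega>. \<Sum>j<k. W j \<omega>) \<in> borel_measurable (?F k)"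
      unfolding W_def
    proof (intro borel_measurable_sum ZF measurable_generated_space X)
      fix j i assume "j \<in> {..<k}" "i \<in> B j"
      then have j: "j < k" and "i \<in> block q (2 * j + p)" using k by (auto simp: B_def)
      then have "i \<le> int (Suc (2 * j + p)) * int q" by (simp add: block_def distrib_right)
      also have "\<dots> \<le> i0 k"
        unfolding i0_def using j by (intro mult_right_mono) auto
      finally show "i \<in> {..i0 k}" by simp
    qed
    show "W k \<in> borel_measurable (?G k)"
      unfolding W_def
    proof (intro borel_measurable_sum ZF measurable_generated_space X)
      fix i assume "i \<in> B k"
      then have "int (2 * k + p) * int q \<le> i"
        using k by (simp add: B_def block_def)
      moreover have "i0 k + int q = int (2 * k + p) * int q"
        by (simp add: i0_def left_diff_distrib)
      ultimately show "i \<in> {i0 k + int q..}" by simp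
    qed
    show "beta_coeff M (sets (?F k)) (sets (?G k)) \<le> beta_mixing_coeff M N X q"
      unfolding sets_generated_space by (rule beta_coeff_le_beta_mixing_coeff[where X=X, OF M X])
  qed (use M X in \<open>auto intro: beta_mixing_coeff_nonneg subalgebra_generated_space open_spectral_norm_greater\<close>)
  moreover have "(\<Sum>k<K. W k \<omega>) = (\<Sum>k<K. \<Sum>i\<in>block q (2 * k + p). Z i \<omega>)" for \<omega>
    by (simp add: W_def B_def)
  ultimately show ?thesis using law by simp
qed

lemma sum_blocks: "(\<Sum>i\<in>{1..int (m * q)}. f i) = (\<Sum>k<m. \<Sum>i\<in>block q k. f i)"
proof (induction m)
  case (Suc m)
  have "{1..int (Suc m * q)} = {1..int (m * q)} \<union> block q m"
    by (auto simp: block_def simp del: of_nat_mult)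
  moreover have "{1..int (m * q)} \<inter> block q m = {}"
    by (auto simp: block_def simp del: of_nat_mult)
  ultimately show ?case
    using Suc by (simp add: block_def sum.union_disjoint)
qed simp

lemma sum_even_odd:
  fixes f :: "nat \<Rightarrow> 'b::comm_monoid_add"
  shows "(\<Sum>k<m. f k) = (\<Sum>k<(m + 1) div 2. f (2 * k)) + (\<Sum>k<m div 2. f (2 * k + 1))"
proof (induction m)
  case (Suc m)
  show ?case
  proof (cases "even m")
    case True
    then obtain l where "m = 2 * l" by blast
    then show ?thesis using Suc by (simp add: add_ac)
  next
    case False
    then obtain l where "m = 2 * l + 1" by (blast elim: oddE)
    then show ?thesis using Suc by (simp add: add_ac)
  qed
qed simp

lemma sum_remainder_block:
  "(\<Sum>i\<in>{1..int n}. f i)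
    = (\<Sum>i\<in>{1..int (n div q * q)}. f i) + (\<Sum>i\<in>remainder_block n q. f i)"
proof -
  define l where "l = int (n div q * q)"
  have l: "0 \<le> l" "l \<le> int n"
    unfolding l_def by (simp_all only: of_nat_0_le_iff of_nat_le_iff div_times_less_eq_dividend)
  have "remainder_block n q = {l + 1..int n}"
    using l by (auto simp: remainder_block_def l_def mult.commute simp del: of_nat_mult)
  moreover have "{1..int n} = {1..l} \<union> {l + 1..int n}" "{1..l} \<inter> {l + 1..int n} = {}"
    using l by auto
  ultimately show ?thesis
    unfolding l_def[symmetric] by (simp add: sum.union_disjoint)
qed

section \<open>The exponential inequality\<close>

text \<open>The union bound in the theorem leaves the threshold \<open>2 t\<close> for each parity, while the target exponent is
\<open>- t\<^sup>2 / (2 d)\<close>. This slack allows the non-optimal \<open>\<theta> = t / (2 d)\<close>: with it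
\<open>k q\<^sup>2 s \<le> d (1 - \<theta> q R / 2)\<close>, so the quadratic term is at most \<open>\<theta>\<^sup>2 d = t\<^sup>2 / (4 d)\<close> and the exponent at
most \<open>- 3 t\<^sup>2 / (4 d)\<close>.\<close>

lemma bernstein_exponent_le:
  fixes s R t :: real and n q k :: nat
  assumes s: "0 \<le> s" and R: "0 \<le> R" and t: "0 < t"
    and kq: "k * q \<le> n"
  defines "d \<equiv> real n * real q * s + q * R * t / 3"
  assumes d: "0 < d"
  defines "\<theta> \<equiv> t / (2 * d)"
  shows "\<theta> * (q * R) < 2"
    and "- \<theta> * (2 * t) + k * (\<theta>\<^sup>2 * ((real q)\<^sup>2 * s) / (1 - \<theta> * (q * R) / 2)) \<le> (- t\<^sup>2 / 2) / d"
proof -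
  have \<theta>: "0 < \<theta>" using t d by (simp add: \<theta>_def)
  have td: "t = 2 * d * \<theta>" using d by (simp add: \<theta>_def)
  have "q * R * t / 3 \<le> d" using s by (simp add: d_def)
  then have "q * R * \<theta> * (2 * d / 3) \<le> 3 / 2 * (2 * d / 3)" by (simp add: td mult_ac)
  then have qR: "\<theta> * (q * R) \<le> 3 / 2" using d by (simp only: mult_le_cancel_right) (simp add: mult_ac)
  then show "\<theta> * (q * R) < 2" by simp
  have "d * (1 - \<theta> * (q * R) / 2) = real n * real q * s + q * R * t / 12"
    using d by (simp add: d_def[symmetric] \<theta>_def right_diff_distrib) (simp add: d_def)
  then have "real n * real q * s \<le> d * (1 - \<theta> * (q * R) / 2)"
    using R t by simp
  moreover have "k * ((real q)\<^sup>2 * s) \<le> real n * real q * s"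
  proof -
    have "real (k * q) * (q * s) \<le> n * (q * s)"
      using kq s by (intro mult_right_mono) (simp_all only: of_nat_le_iff, simp)
    then show ?thesis by (simp add: power2_eq_square mult_ac)
  qed
  ultimately have "k * ((real q)\<^sup>2 * s) / (1 - \<theta> * (q * R) / 2) \<le> d"
    using qR by (simp add: pos_divide_le_eq)
  then have "\<theta>\<^sup>2 * (k * ((real q)\<^sup>2 * s) / (1 - \<theta> * (q * R) / 2)) \<le> \<theta>\<^sup>2 * d"
    by (intro mult_left_mono) auto
  then have "- \<theta> * (2 * t) + k * (\<theta>\<^sup>2 * ((real q)\<^sup>2 * s) / (1 - \<theta> * (q * R) / 2)) \<le> - \<theta> * (2 * t) + \<theta>\<^sup>2 * d"
    by (simp add: mult_ac)
  also have "\<dots> = - (3 / 4) * t\<^sup>2 / d"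
    using d by (simp add: \<theta>_def power2_eq_square field_simps)
  also have "\<dots> \<le> (- t\<^sup>2 / 2) / d"
    using d by (intro divide_right_mono) auto
  finally show "- \<theta> * (2 * t) + k * (\<theta>\<^sup>2 * ((real q)\<^sup>2 * s) / (1 - \<theta> * (q * R) / 2)) \<le> (- t\<^sup>2 / 2) / d" .
qed

theorem theorem4p2:
  fixes M :: "'a measure" and N :: "'x measure"
    and X :: "int \<Rightarrow> 'a \<Rightarrow> 'x"
    and \<Xi> :: "nat \<Rightarrow> 'x \<Rightarrow> real^'d2^'d1"
    and R :: "nat \<Rightarrow> real"
    and n q :: nat and t :: real
  assumes "prob_space M"
    and "\<And>i. X i \<in> measurable M N"
    and "beta_mixing M N X"
    and "\<And>n. \<Xi> n \<in> borel_measurable N"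
    and "\<And>n i. integral\<^sup>L M (\<lambda>\<omega>. \<Xi> n (X i \<omega>)) = 0"
    and "\<And>n i. AE \<omega> in M. spectral_norm (\<Xi> n (X i \<omega>)) \<le> R n"
    and "1 \<le> q" and "real q \<le> real n / 2"
    and "0 \<le> t"
  shows "measure M {\<omega> \<in> space M. spectral_norm (\<Sum>i\<in>{1..int n}. \<Xi> n (X i \<omega>)) \<ge> 6 * t}
    \<le> real n / real q * beta_mixing_coeff M N X q
      + measure M {\<omega> \<in> space M. spectral_norm (\<Sum>i\<in>remainder_block n q. \<Xi> n (X i \<omega>)) \<ge> t}
      + 2 * (real CARD('d1) + real CARD('d2))
        * exp ((- t\<^sup>2 / 2)
               / (real n * real q * max_second_moment M (\<lambda>i \<omega>. \<Xi> n (X i \<omega>)) n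
                  + real q * R n * t / 3))"
proof -
  interpret prob_space M by fact
  note X = assms(2)
  let ?Z = "\<lambda>i \<omega>. \<Xi> n (X i \<omega>)"
  let ?s = "max_second_moment M ?Z n"
  let ?\<beta> = "beta_mixing_coeff M N X q"
  let ?C = "real CARD('d1) + real CARD('d2)"
  let ?All = "{\<omega> \<in> space M. 6 * t \<le> spectral_norm (\<Sum>i\<in>{1..int n}. ?Z i \<omega>)}"
  let ?Rem = "{\<omega> \<in> space M. t \<le> spectral_norm (\<Sum>i\<in>remainder_block n q. ?Z i \<omega>)}"
  define m where "m = n div q"
  define d where "d = real n * real q * ?s + real q * R n * t / 3"
  have [measurable]: "?Z i \<in> borel_measurable M" for i
    using X assms(4) by measurable
  have n: "1 \<le> n" using assms(7,8) by linarith
  have s: "0 \<le> ?s" by (rule max_second_moment_nonneg[OF n])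
  have R: "0 \<le> R n"
  proof -
    have "AE \<omega> in M. 0 \<le> R n"
      using assms(6)[of n 0] by eventually_elim (rule order_trans[OF spectral_norm_nonneg])
    then show ?thesis by simp
  qed
  have \<beta>: "0 \<le> ?\<beta>" by (rule beta_mixing_coeff_nonneg[OF assms(1) X])
  have d: "0 \<le> d" using s R assms(9) by (simp add: d_def)
  have goal: "measure M ?All \<le> real n / real q * ?\<beta> + measure M ?Rem + 2 * ?C * exp ((- t\<^sup>2 / 2) / d)"
  proof (cases "t = 0 \<or> d = 0")
    case True
    \<comment> \<open>Since \<open>x / 0 = 0\<close>, the exponential factor is 1 in both cases.\<close>
    then have one: "exp ((- t\<^sup>2 / 2) / d) = 1" by auto
    have sum: "1 \<le> 2 * (a + b)" if "1 \<le> a" "0 \<le> b" for a b :: real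
      using that by simp
    have "prob ?All \<le> 1" by (rule prob_le_1)
    also have "1 \<le> 2 * ?C" by (rule sum) (simp_all add: Suc_le_eq)
    also have "\<dots> = 0 + 0 + 2 * ?C * exp ((- t\<^sup>2 / 2) / d)" unfolding one by simp
    also have "\<dots> \<le> real n / real q * ?\<beta> + prob ?Rem + 2 * ?C * exp ((- t\<^sup>2 / 2) / d)"
      using \<beta> by (intro add_mono order_refl mult_nonneg_nonneg) auto
    finally show ?thesis .
  next
    case False
    then have t: "0 < t" and d: "0 < d" using assms(9) d by auto
    define \<theta> where "\<theta> = t / (2 * d)"
    have \<theta>: "0 < \<theta>" using t d by (simp add: \<theta>_def)
    have mq: "m * q \<le> n" by (simp add: m_def)
    define S where "S p k \<omega> = (\<Sum>j<k. \<Sum>i\<in>block q (2 * j + p). ?Z i \<omega>)" for p k \<omega>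
    have tail: "prob {\<omega> \<in> space M. 2 * t < spectral_norm (S p k \<omega>)}
        \<le> ?C * exp ((- t\<^sup>2 / 2) / d) + k * ?\<beta>"
      if p: "p \<le> 1" and k: "2 * k + p \<le> m + 1" "k \<le> m" for p k
    proof -
      have kq: "k * q \<le> n" using k(2) mq by (meson le_trans mult_le_mono1)
      have "(2 * k + p) * q \<le> (m + 1) * q" using k(1) by (rule mult_le_mono1)
      then have K: "(2 * k + p) * q \<le> n + q" using mq by simp
      note ex = bernstein_exponent_le[OF s R t kq, folded d_def, OF d, folded \<theta>_def]
      have "prob {\<omega> \<in> space M. 2 * t < spectral_norm (S p k \<omega>)}
        \<le> (CARD('d1) + CARD('d2)) * exp (- \<theta> * (2 * t)
          + k * (\<theta>\<^sup>2 * ((real q)\<^sup>2 * ?s) / (1 - \<theta> * (q * R n) / 2))) + k * ?\<beta>"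
        unfolding S_def using t
        by (intro alternate_blocks_tail_le[where X=X and \<Xi>="\<Xi> n",
              OF assms(1) X assms(4-6) R K n p \<theta> ex(1)]) simp
      also have "\<dots> \<le> (CARD('d1) + CARD('d2)) * exp ((- t\<^sup>2 / 2) / d) + k * ?\<beta>"
        using ex(2) by (intro add_right_mono mult_left_mono) auto
      finally show ?thesis by simp
    qed
    let ?Even = "{\<omega> \<in> space M. 2 * t < spectral_norm (S 0 ((m + 1) div 2) \<omega>)}"
    let ?Odd = "{\<omega> \<in> space M. 2 * t < spectral_norm (S 1 (m div 2) \<omega>)}"
    have [measurable]: "S p k \<in> borel_measurable M" for p k
      unfolding S_def by measurable
    have "?All \<subseteq> ?Rem \<union> ?Even \<union> ?Odd"
    proof
      fix \<omega> assume \<omega>: "\<omega> \<in> ?All"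
      have split: "(\<Sum>i\<in>{1..int n}. ?Z i \<omega>)
          = S 0 ((m + 1) div 2) \<omega> + S 1 (m div 2) \<omega> + (\<Sum>i\<in>remainder_block n q. ?Z i \<omega>)"
        unfolding sum_remainder_block[of _ n q] sum_blocks m_def[symmetric] sum_even_odd[of _ m] S_def
        by simp
      have "6 * t \<le> spectral_norm (\<Sum>i\<in>{1..int n}. ?Z i \<omega>)"
        using \<omega> by simp
      also have "\<dots> \<le> spectral_norm (S 0 ((m + 1) div 2) \<omega> + S 1 (m div 2) \<omega>)
          + spectral_norm (\<Sum>i\<in>remainder_block n q. ?Z i \<omega>)"
        unfolding split by (rule spectral_norm_add_le)
      also have "\<dots> \<le> spectral_norm (S 0 ((m + 1) div 2) \<omega>) + spectral_norm (S 1 (m div 2) \<omega>)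
          + spectral_norm (\<Sum>i\<in>remainder_block n q. ?Z i \<omega>)"
        by (intro add_right_mono spectral_norm_add_le)
      finally have "t \<le> spectral_norm (\<Sum>i\<in>remainder_block n q. ?Z i \<omega>)
          \<or> 2 * t < spectral_norm (S 0 ((m + 1) div 2) \<omega>)
          \<or> 2 * t < spectral_norm (S 1 (m div 2) \<omega>)"
        using t by linarith
      then show "\<omega> \<in> ?Rem \<union> ?Even \<union> ?Odd" using \<omega> by auto
    qed
    then have "prob ?All \<le> prob (?Rem \<union> ?Even \<union> ?Odd)"
      by (intro finite_measure_mono) measurable
    also have "\<dots> \<le> prob ?Rem + prob ?Even + prob ?Odd"
      by (intro order_trans[OF measure_Un_le add_right_mono] measure_Un_le) measurable
    also have "\<dots> \<le> prob ?Rem + (?C * exp ((- t\<^sup>2 / 2) / d) + ((m + 1) div 2) * ?\<beta>)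
        + (?C * exp ((- t\<^sup>2 / 2) / d) + (m div 2) * ?\<beta>)"
    proof -
      have "(m + 1) div 2 \<le> m"
        using div_le_mono[of q n q] assms(7,8) by (simp add: m_def)
      then have "prob ?Even \<le> ?C * exp ((- t\<^sup>2 / 2) / d) + ((m + 1) div 2) * ?\<beta>"
        by (intro tail) auto
      moreover have "prob ?Odd \<le> ?C * exp ((- t\<^sup>2 / 2) / d) + (m div 2) * ?\<beta>"
        by (intro tail) auto
      ultimately show ?thesis by (intro add_mono order_refl)
    qed
    also have "\<dots> = prob ?Rem + 2 * ?C * exp ((- t\<^sup>2 / 2) / d) + real ((m + 1) div 2 + m div 2) * ?\<beta>"
      by (simp add: algebra_simps)
    also have "(m + 1) div 2 + m div 2 = m" by presburger
    also have "real m * ?\<beta> \<le> real n / real q * ?\<beta>"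
      using \<beta> mq assms(7) by (intro mult_right_mono) (simp_all add: pos_le_divide_eq flip: of_nat_mult)
    finally show ?thesis by (simp add: add_ac)
  qed
  then show ?thesis unfolding d_def .
qed

end
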